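(* Let $M\in R^{g\times g}$ be of full rank and let $\theta$ be an involution of $R$. Then the algorithm DIAG described in the context, applied to $M$, terminates and is correct. That is: let $M^{(i)}$ denote the matrix obtained after the $i$-th execution of the while loop. Then there exists $k\in\mathbb{N}$ such that $M^{(k)}$ is a diagonal matrix. If $k$ (the first such index) is odd, then the while loop is repeated just one more time, so that the loop is executed $l:=k+(k \bmod 2)$ times in total. The matrices $U,V\in R^{g\times g}$ obtained in the last loop are unimodular and satisfy $UMV=\mathrm{Diag}(m_1,\ldots,m_g)$ for some $m_1,\dots,m_g\in R$, this diagonal matrix being the returned matrix $M^{(l)}$.
   Context: **$G$-algebras.** Let $K$ be a field. A $G$-algebra in variables $y_1,\ldots,y_m$ is a quotient of $K\langle y_1,\ldots,y_m\rangle$ by the two-sided ideal $I$ generated by $y_jy_i-c_{ij}y_iy_j-d_{ij}$ ($1\le i<j\le m$), with $c_{ij}\in K\setminus\{0\}$ and $d_{ij}$ polynomials in standard monomials $y_1^{a_1}\cdots y_m^{a_m}$, such that (a) for $i<j<k$ the expression $c_{ik}c_{jk}d_{ij}y_k-y_kd_{ij}+c_{jk}y_jd_{ik}-c_{ij}d_{ik}y_j+d_{jk}y_i-c_{ij}c_{ik}y_id_{jk}$ reduces to zero modulo $I$, and (b) there is a monomial well-ordering $\prec$ (called admissible) with $\mathrm{lm}(d_{ij})\prec y_iy_j$ whenever $d_{ij}\ne0$. A $G$-algebra is a Noetherian domain with $K$-basis the standard monomials; $\mathrm{Quot}(\cdot)$ denotes its skew field of fractions. **Setting.** $A_*$ is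 a $G$-algebra over $K$ generated by $x_1,\ldots,x_n$, and $R_*=A_*[\partial;\sigma,\delta]$ is an Ore extension of $A_*$ which is a $G$-algebra generated by $x_1,\ldots,x_n,\partial$. Put $A=\mathrm{Quot}(A_* )$ and let $R=A[\partial;\sigma,\delta]$ (the Ore localization of $R_*$ at $A_*\setminus\{0\}$; $\sigma$ is an automorphism of $A$ and $\delta$ a $\sigma$-derivation, $\partial a=\sigma(a)\partial+\delta(a)$ for $a\in A$). $R$ is a left and right Euclidean domain and left and right principal ideal domain. Rank of a matrix over $R$ means rank over the skew field of fractions of $R$. A square matrix over $R$ is unimodular if it has a two-sided inverse over $R$. **Involution.** An involution $\theta$ of $R$ is a $K$-linear map $R\to R$ with $\theta(ab)=\theta(b)\theta(a)$ and $\theta^2=\mathrm{id}$. For a matrix $N$ over $R$, $\widetilde\theta(N):=(\theta(N_{ij}))^T$. **Gröbner bases over $R$.** Monomials of the free left module $R^{1\times q}$ are $\partial^ke_i$ ($k\ge0$, $e_i$ the $i$-th unit vector), ordered by $\partial^ke_i<\partial^le_j$ iff $i<j$, or $i=j$ and $k<l$. $\mathrm{lm}$ denotes the leading monomial with respect to this ordering. $\partial^ke_i$ divides $\partial^le_j$ iff $i=j$ and $k\le l$. A finite subset $G$ of a left submodule $N$ is a Gröbner basis if for each $f\in N\setminus\{0\}$ some $h\in G$ has $\mathrm{lm}(h)$ dividing $\mathrm{lm}(f)$; it is reduced if for any $h\neq f\in G$, $\mathrm{lm}(h)$ divides no monomial of $f$ (reduced Gröbner bases are taken normalized, i.e. with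 leading coefficients $1$, and are then unique). ${}_RN$ denotes the left $R$-module generated by the rows of the matrix $N$, and $\mathcal{G}({}_RN)$ its reduced left Gröbner basis, identified with the matrix whose rows are its elements ordered by increasing leading monomial (for a full rank $g\times g$ matrix this is a lower triangular $g\times g$ matrix). **Algorithm DIAG.** Input: $M\in R^{g\times g}$ of full rank and $\theta$. Set $M^{(0)}\leftarrow M$, $U\leftarrow\mathrm{id}$, $V\leftarrow\mathrm{id}$, $i\leftarrow0$. While ($M^{(i)}$ is not diagonal or $i$ is odd) do: $i\leftarrow i+1$; compute $U^{(i)}$ such that $U^{(i)}M^{(i-1)}=\mathcal{G}({}_RM^{(i-1)})$; $M^{(i)}\leftarrow\widetilde\theta(\mathcal{G}({}_RM^{(i-1)}))$; if $i$ is even, $V\leftarrow V\cdot\widetilde\theta(U^{(i)})$, else $U\leftarrow U^{(i)}\cdot U$. Return $(U,V,M^{(i)})$. *)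

theory Defs
  imports
    "HOL-Library.Poly_Mapping"
    "HOL-Library.Multiset"
    "HOL-Library.While_Combinator"
    "HOL-Computational_Algebra.Polynomial"
    "Jordan_Normal_Form.Matrix"
begin

section \<open>Free algebras and $G$-algebras\<close>

text \<open>Words under concatenation, written additively so that the convolution product of
  \<^theory>\<open>HOL-Library.Poly_Mapping\<close> makes finitely supported functions on words into the free
  associative algebra. Variables are numbered from 0: the letter \<open>i\<close> stands for
  $y_{i+1}$.\<close>

datatype word = Word (letters: "nat list")

instantiation word :: monoid_add
begin

definition zero_word :: word where "0 = Word []"

definition plus_word :: "word \<Rightarrow> word \<Rightarrow> word" where "u + v = Word (letters u @ letters v)"

instance
  by standard (auto simp: zero_word_def plus_word_def)

end

type_synonym 'k free_alg = "word \<Rightarrow>\<^sub>0 'k"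

definition free_algebra :: "nat \<Rightarrow> 'k::field free_alg set" where
  "free_algebra m = {f. \<forall>w \<in> Poly_Mapping.keys f. set (letters w) \<subseteq> {..<m}}"

definition fconst :: "'k::field \<Rightarrow> 'k free_alg" where
  "fconst a = Poly_Mapping.single 0 a"

definition fvar :: "nat \<Rightarrow> 'k::field free_alg" where
  "fvar i = Poly_Mapping.single (Word [i]) 1"

definition standard_polys :: "nat \<Rightarrow> 'k::field free_alg set" where
  "standard_polys m = {f \<in> free_algebra m. \<forall>w \<in> Poly_Mapping.keys f. sorted (letters w)}"

definition two_sided_ideal_generated :: "'a::ring_1 set \<Rightarrow> 'a set \<Rightarrow> 'a set" where
  "two_sided_ideal_generated S X = \<Inter>{J. J \<subseteq> S \<and> X \<subseteq> J \<and> 0 \<in> J \<and>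
     (\<forall>a\<in>J. \<forall>b\<in>J. a + b \<in> J) \<and> (\<forall>r\<in>S. \<forall>a\<in>J. r * a \<in> J \<and> a * r \<in> J)}"

definition greatest_wrt :: "('m \<Rightarrow> 'm \<Rightarrow> bool) \<Rightarrow> 'm set \<Rightarrow> 'm" where
  "greatest_wrt lt S = (THE m. m \<in> S \<and> (\<forall>m'\<in>S. m' \<noteq> m \<longrightarrow> lt m' m))"

text \<open>A standard monomial $y_1^{a_1}\cdots y_m^{a_m}$ is a sorted word; for comparing monomials it
  is identified with the multiset of its letters, i.e. with the exponent vector
  $(a_1,\ldots,a_m)$, so that multiset union is addition of exponents.\<close>

definition monomial_well_ordering :: "nat \<Rightarrow> (nat multiset \<Rightarrow> nat multiset \<Rightarrow> bool) \<Rightarrow> bool" where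
  "monomial_well_ordering m prec \<longleftrightarrow>
     (let Mon = {\<alpha>. set_mset \<alpha> \<subseteq> {..<m}} in
       (\<forall>\<alpha>\<in>Mon. \<not> prec \<alpha> \<alpha>) \<and>
       (\<forall>\<alpha>\<in>Mon. \<forall>\<beta>\<in>Mon. \<forall>\<gamma>\<in>Mon. prec \<alpha> \<beta> \<longrightarrow> prec \<beta> \<gamma> \<longrightarrow> prec \<alpha> \<gamma>) \<and>
       (\<forall>\<alpha>\<in>Mon. \<forall>\<beta>\<in>Mon. \<alpha> = \<beta> \<or> prec \<alpha> \<beta> \<or> prec \<beta> \<alpha>) \<and>
       wfp_on Mon prec \<and>
       (\<forall>\<alpha>\<in>Mon. \<forall>\<beta>\<in>Mon. \<forall>\<gamma>\<in>Mon. prec \<alpha> \<beta> \<longrightarrow> prec (\<alpha> + \<gamma>) (\<beta> + \<gamma>)))"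

definition std_lm :: "(nat multiset \<Rightarrow> nat multiset \<Rightarrow> bool) \<Rightarrow> 'k::field free_alg \<Rightarrow> nat multiset" where
  "std_lm prec f = greatest_wrt prec ((\<lambda>w. mset (letters w)) ` Poly_Mapping.keys f)"

definition G_rel :: "(nat \<Rightarrow> nat \<Rightarrow> 'k::field) \<Rightarrow> (nat \<Rightarrow> nat \<Rightarrow> 'k free_alg) \<Rightarrow>
    nat \<Rightarrow> nat \<Rightarrow> 'k free_alg" where
  "G_rel c d i j = fvar j * fvar i - fconst (c i j) * fvar i * fvar j - d i j"

definition G_ideal :: "nat \<Rightarrow> (nat \<Rightarrow> nat \<Rightarrow> 'k::field) \<Rightarrow> (nat \<Rightarrow> nat \<Rightarrow> 'k free_alg) \<Rightarrow>
    'k free_alg set" where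
  "G_ideal m c d = two_sided_ideal_generated (free_algebra m) {G_rel c d i j |i j. i < j \<and> j < m}"

text \<open>One rewriting step with the rules $y_jy_i \to c_{ij}y_iy_j + d_{ij}$ ($i<j$), applied to a
  word $u\,y_jy_i\,v$ that occurs in \<open>f\<close>. The overlap expression in \<open>nondegenerate\<close> below always
  lies in the ideal, being a difference of two rewritings of $y_ky_jy_i$; so the condition that it
  reduces to zero has to be read as a statement about rewriting.\<close>

definition G_reduces :: "nat \<Rightarrow> (nat \<Rightarrow> nat \<Rightarrow> 'k::field) \<Rightarrow> (nat \<Rightarrow> nat \<Rightarrow> 'k free_alg) \<Rightarrow>
    'k free_alg \<Rightarrow> 'k free_alg \<Rightarrow> bool" where
  "G_reduces m c d f f' \<longleftrightarrow> (\<exists>u v i j a. i < j \<and> j < m \<and>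
     a = Poly_Mapping.lookup f (u + Word [j, i] + v) \<and> a \<noteq> 0 \<and>
     f' = f - Poly_Mapping.single u a * G_rel c d i j * Poly_Mapping.single v 1)"

definition nondegenerate :: "nat \<Rightarrow> (nat \<Rightarrow> nat \<Rightarrow> 'k::field) \<Rightarrow> (nat \<Rightarrow> nat \<Rightarrow> 'k free_alg) \<Rightarrow> bool" where
  "nondegenerate m c d \<longleftrightarrow> (\<forall>i j k. i < j \<and> j < k \<and> k < m \<longrightarrow>
     (G_reduces m c d)\<^sup>*\<^sup>*
       (fconst (c i k * c j k) * d i j * fvar k - fvar k * d i j
        + fconst (c j k) * fvar j * d i k - fconst (c i j) * d i k * fvar j
        + d j k * fvar i - fconst (c i j * c i k) * fvar i * d j k)
       0)"

definition G_data :: "nat \<Rightarrow> (nat \<Rightarrow> nat \<Rightarrow> 'k::field) \<Rightarrow> (nat \<Rightarrow> nat \<Rightarrow> 'k free_alg) \<Rightarrow> bool" where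
  "G_data m c d \<longleftrightarrow>
     (\<forall>i j. i < j \<and> j < m \<longrightarrow> c i j \<noteq> 0 \<and> d i j \<in> standard_polys m) \<and>
     nondegenerate m c d \<and>
     (\<exists>prec. monomial_well_ordering m prec \<and>
        (\<forall>i j. i < j \<and> j < m \<and> d i j \<noteq> 0 \<longrightarrow> prec (std_lm prec (d i j)) {#i, j#}))"

locale k_algebra = vector_space scale
  for scale :: "'k::field \<Rightarrow> 'r::ring_1 \<Rightarrow> 'r" +
  assumes scale_mult_left: "scale a (x * y) = scale a x * y"
    and scale_mult_right: "scale a (x * y) = x * scale a y"

definition free_eval :: "('k::field \<Rightarrow> 'r::ring_1 \<Rightarrow> 'r) \<Rightarrow> (nat \<Rightarrow> 'r) \<Rightarrow> 'k free_alg \<Rightarrow> 'r" where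
  "free_eval scale y f =
     (\<Sum>w\<in>Poly_Mapping.keys f. scale (Poly_Mapping.lookup f w) (prod_list (map y (letters w))))"

text \<open>The subset \<open>B\<close> of the ambient \<open>K\<close>-algebra is a $G$-algebra in the variables
  \<open>y 0, \<dots>, y (m - 1)\<close>: the evaluation map $K\langle y_1,\ldots,y_m\rangle \to B$ is onto with
  kernel the ideal $I$, i.e. it identifies \<open>B\<close> with the quotient by $I$.\<close>

definition G_algebra :: "('k::field \<Rightarrow> 'r::ring_1 \<Rightarrow> 'r) \<Rightarrow> nat \<Rightarrow> (nat \<Rightarrow> 'r) \<Rightarrow> 'r set \<Rightarrow> bool" where
  "G_algebra scale m y B \<longleftrightarrow> (\<exists>c d. G_data m c d \<and>
     free_eval scale y ` free_algebra m = B \<and>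
     {f \<in> free_algebra m. free_eval scale y f = 0} = G_ideal m c d)"


section \<open>Skew fields of fractions, Ore extensions, involutions\<close>

definition subring_of :: "'r::ring_1 set \<Rightarrow> 'r set \<Rightarrow> bool" where
  "subring_of B S \<longleftrightarrow> B \<subseteq> S \<and> 1 \<in> B \<and> (\<forall>a\<in>B. \<forall>b\<in>B. a - b \<in> B \<and> a * b \<in> B)"

text \<open>The equation \<open>s * q = a\<close> says $q = s^{-1}a$. For a Noetherian domain (which satisfies both
  Ore conditions) left and right fractions give the same skew field.\<close>

definition skew_field_of_fractions :: "'r::ring_1 set \<Rightarrow> 'r set \<Rightarrow> bool" where
  "skew_field_of_fractions F B \<longleftrightarrow>
     subring_of F UNIV \<and> subring_of B F \<and>
     (\<forall>q\<in>F. q \<noteq> 0 \<longrightarrow> (\<exists>q'\<in>F. q * q' = 1 \<and> q' * q = 1)) \<and>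
     (\<forall>q\<in>F. \<exists>s\<in>B. \<exists>a\<in>B. s \<noteq> 0 \<and> s * q = a)"

text \<open>Coefficients stand to the left of powers of \<open>D\<close>; the type \<^typ>\<open>'r poly\<close> only serves to
  store them.\<close>

definition ore_eval :: "'r::ring_1 \<Rightarrow> 'r poly \<Rightarrow> 'r" where
  "ore_eval D p = (\<Sum>k\<le>degree p. coeff p k * D ^ k)"

definition polys_over :: "'r::ring_1 set \<Rightarrow> 'r poly set" where
  "polys_over B = {p. \<forall>k. coeff p k \<in> B}"

text \<open>\<open>S = B[D; \<sigma>, \<delta>]\<close>: the ring \<open>S\<close> contains \<open>B\<close>, is a free left \<open>B\<close>-module on the powers of
  \<open>D\<close>, and \<open>D a = \<sigma>(a) D + \<delta>(a)\<close>. Only the values of \<open>\<sigma>\<close> and \<open>\<delta>\<close> on \<open>B\<close> matter.\<close>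

definition ore_extension ::
    "'r::ring_1 set \<Rightarrow> 'r set \<Rightarrow> 'r \<Rightarrow> ('r \<Rightarrow> 'r) \<Rightarrow> ('r \<Rightarrow> 'r) \<Rightarrow> bool" where
  "ore_extension S B D \<sigma> \<delta> \<longleftrightarrow>
     subring_of S UNIV \<and> subring_of B S \<and> D \<in> S \<and>
     \<sigma> ` B \<subseteq> B \<and> \<delta> ` B \<subseteq> B \<and> \<sigma> 1 = 1 \<and>
     (\<forall>a\<in>B. \<forall>b\<in>B. \<sigma> (a + b) = \<sigma> a + \<sigma> b \<and> \<sigma> (a * b) = \<sigma> a * \<sigma> b) \<and>
     (\<forall>a\<in>B. \<forall>b\<in>B. \<delta> (a + b) = \<delta> a + \<delta> b \<and> \<delta> (a * b) = \<sigma> a * \<delta> b + \<delta> a * b) \<and>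
     (\<forall>a\<in>B. D * a = \<sigma> a * D + \<delta> a) \<and>
     bij_betw (ore_eval D) (polys_over B) S"

definition ore_coeff :: "'r::ring_1 set \<Rightarrow> 'r \<Rightarrow> 'r \<Rightarrow> nat \<Rightarrow> 'r" where
  "ore_coeff A D r = coeff (the_inv_into (polys_over A) (ore_eval D) r)"

definition involution :: "('k::field \<Rightarrow> 'r::ring_1 \<Rightarrow> 'r) \<Rightarrow> ('r \<Rightarrow> 'r) \<Rightarrow> bool" where
  "involution scale \<theta> \<longleftrightarrow> Vector_Spaces.linear scale scale \<theta> \<and>
     (\<forall>a b. \<theta> (a * b) = \<theta> b * \<theta> a) \<and> (\<forall>a. \<theta> (\<theta> a) = a)"

definition theta_mat :: "('r \<Rightarrow> 'r) \<Rightarrow> 'r mat \<Rightarrow> 'r mat" where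
  "theta_mat \<theta> N = transpose_mat (map_mat \<theta> N)"

text \<open>Rank over a skew field: the maximal number of left linearly independent rows.\<close>

definition left_independent_rows :: "'q::division_ring mat \<Rightarrow> nat set \<Rightarrow> bool" where
  "left_independent_rows N S \<longleftrightarrow>
     (\<forall>c. (\<forall>j<dim_col N. (\<Sum>i\<in>S. c i * N $$ (i, j)) = 0) \<longrightarrow> (\<forall>i\<in>S. c i = 0))"

definition skew_rank :: "'q::division_ring mat \<Rightarrow> nat" where
  "skew_rank N = Max {card S |S. S \<subseteq> {..<dim_row N} \<and> left_independent_rows N S}"


section \<open>Groebner bases over $R$\<close>

text \<open>The pair \<open>(i, k)\<close> stands for the monomial $\partial^k e_{i+1}$ of $R^{1\times q}$.\<close>

definition mon_less :: "nat \<times> nat \<Rightarrow> nat \<times> nat \<Rightarrow> bool" where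
  "mon_less s t \<longleftrightarrow> fst s < fst t \<or> fst s = fst t \<and> snd s < snd t"

definition mon_divides :: "nat \<times> nat \<Rightarrow> nat \<times> nat \<Rightarrow> bool" where
  "mon_divides s t \<longleftrightarrow> fst s = fst t \<and> snd s \<le> snd t"

definition monomials_of :: "'r::ring_1 set \<Rightarrow> 'r \<Rightarrow> 'r vec \<Rightarrow> (nat \<times> nat) set" where
  "monomials_of A D f = {(i, k). i < dim_vec f \<and> ore_coeff A D (f $ i) k \<noteq> 0}"

definition lm :: "'r::ring_1 set \<Rightarrow> 'r \<Rightarrow> 'r vec \<Rightarrow> nat \<times> nat" where
  "lm A D f = greatest_wrt mon_less (monomials_of A D f)"

definition lc :: "'r::ring_1 set \<Rightarrow> 'r \<Rightarrow> 'r vec \<Rightarrow> 'r" where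
  "lc A D f = ore_coeff A D (f $ fst (lm A D f)) (snd (lm A D f))"

definition row_module :: "'r::ring_1 mat \<Rightarrow> 'r vec set" where
  "row_module N = {vec (dim_col N) (\<lambda>j. \<Sum>i<dim_row N. r i * N $$ (i, j)) |r. True}"

definition groebner_basis :: "'r::ring_1 set \<Rightarrow> 'r \<Rightarrow> nat \<Rightarrow> 'r vec set \<Rightarrow> 'r vec set \<Rightarrow> bool" where
  "groebner_basis A D q L G \<longleftrightarrow> finite G \<and> G \<subseteq> L \<and>
     (\<forall>f\<in>L. f \<noteq> 0\<^sub>v q \<longrightarrow> (\<exists>h\<in>G. h \<noteq> 0\<^sub>v q \<and> mon_divides (lm A D h) (lm A D f)))"

definition reduced_groebner_basis ::
    "'r::ring_1 set \<Rightarrow> 'r \<Rightarrow> nat \<Rightarrow> 'r vec set \<Rightarrow> 'r vec set \<Rightarrow> bool" where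
  "reduced_groebner_basis A D q L G \<longleftrightarrow> groebner_basis A D q L G \<and>
     (\<forall>h\<in>G. h \<noteq> 0\<^sub>v q \<and> lc A D h = 1) \<and>
     (\<forall>f\<in>G. \<forall>h\<in>G. h \<noteq> f \<longrightarrow> (\<forall>t\<in>monomials_of A D f. \<not> mon_divides (lm A D h) t))"

definition is_gb_matrix :: "'r::ring_1 set \<Rightarrow> 'r \<Rightarrow> 'r mat \<Rightarrow> 'r mat \<Rightarrow> bool" where
  "is_gb_matrix A D N G \<longleftrightarrow> dim_col G = dim_col N \<and>
     sorted_wrt (\<lambda>f h. mon_less (lm A D f) (lm A D h)) (rows G) \<and>
     reduced_groebner_basis A D (dim_col N) (row_module N) (set (rows G))"

definition gb_matrix :: "'r::ring_1 set \<Rightarrow> 'r \<Rightarrow> 'r mat \<Rightarrow> 'r mat" where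
  "gb_matrix A D N = (THE G. is_gb_matrix A D N G)"


section \<open>The algorithm DIAG\<close>

definition is_gb_transform :: "'r::ring_1 set \<Rightarrow> 'r \<Rightarrow> 'r mat \<Rightarrow> 'r mat \<Rightarrow> bool" where
  "is_gb_transform A D N W \<longleftrightarrow>
     W \<in> carrier_mat (dim_row (gb_matrix A D N)) (dim_row N) \<and> W * N = gb_matrix A D N"

definition gb_transform :: "'r::ring_1 set \<Rightarrow> 'r \<Rightarrow> 'r mat \<Rightarrow> 'r mat" where
  "gb_transform A D N = (SOME W. is_gb_transform A D N W)"

text \<open>States are tuples $(i, U, V, M^{(i)})$; the counter \<open>i\<close> is the number of executions of the
  loop body so far.\<close>

type_synonym 'r diag_state = "nat \<times> 'r mat \<times> 'r mat \<times> 'r mat"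

definition diag_init :: "nat \<Rightarrow> 'r::ring_1 mat \<Rightarrow> 'r diag_state" where
  "diag_init g M = (0, 1\<^sub>m g, 1\<^sub>m g, M)"

fun diag_guard :: "'r::ring_1 diag_state \<Rightarrow> bool" where
  "diag_guard (i, U, V, N) \<longleftrightarrow> \<not> diagonal_mat N \<or> odd i"

fun diag_body :: "'r::ring_1 set \<Rightarrow> 'r \<Rightarrow> ('r \<Rightarrow> 'r) \<Rightarrow> 'r diag_state \<Rightarrow> 'r diag_state" where
  "diag_body A D \<theta> (i, U, V, N) =
     (let i' = i + 1; W = gb_transform A D N; N' = theta_mat \<theta> (gb_matrix A D N)
      in if even i' then (i', U, V * theta_mat \<theta> W, N')
         else (i', W * U, V, N'))"

definition diag_M :: "'r::ring_1 set \<Rightarrow> 'r \<Rightarrow> ('r \<Rightarrow> 'r) \<Rightarrow> nat \<Rightarrow> 'r mat \<Rightarrow> nat \<Rightarrow> 'r mat" where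
  "diag_M A D \<theta> g M i = (snd \<circ> snd \<circ> snd) ((diag_body A D \<theta> ^^ i) (diag_init g M))"

text \<open>\<^const>\<open>None\<close> means that the loop does not terminate.\<close>

definition DIAG :: "'r::ring_1 set \<Rightarrow> 'r \<Rightarrow> ('r \<Rightarrow> 'r) \<Rightarrow> nat \<Rightarrow> 'r mat \<Rightarrow> 'r diag_state option" where
  "DIAG A D \<theta> g M = while_option diag_guard (diag_body A D \<theta>) (diag_init g M)"

end

theory Submission
  imports Defs
begin

text \<open>Every unit of $R$ has degree 0, so an involution maps $A$ onto itself; comparing the degrees of
  $\partial$, $\theta(\partial)$ and $\theta(\theta(\partial))$ then shows that $\theta$ preserves
  degrees (\<open>deg_\<theta>\<close>). This is what makes the loop terminate.

  For a matrix of full rank the rows generate a module with leading monomials in every position, and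
  the reduced Groebner basis of such a module is its Hermite form: a lower triangular matrix with
  monic diagonal entries of least possible degree, each entry below the diagonal having smaller degree
  than the diagonal entry of its column (\<open>hermite_form_is_gb_matrix\<close>, \<open>is_gb_matrix_unique\<close>,
  \<open>full_rank_leads\<close>). The Groebner basis and the matrix generate the same row module, so
  the transformation between them is unimodular (\<open>full_rank_gb\<close>).

  Let $H$ and $H'$ be consecutive Hermite forms, so that $H'$ is the Hermite form of the upper triangular
  matrix $\widetilde\theta(H)$. Suppose that below row $t$ all off-diagonal entries of $H$ vanish. Then
  this persists for $H'$, and row $t$ of $\widetilde\theta(H)$ is $\theta(H_{tt})e_t$. By minimality,
  $\deg H'_{tt}\le\deg\theta(H_{tt})=\deg H_{tt}$. In the case of equality a unit multiple of
  $\theta(H_{tt})e_t$ already has all properties of row $t$ of $H'$; being unique, that row has no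
  off-diagonal entry (\<open>pivot_step\<close>). As a degree cannot drop forever, row $t$ becomes
  diagonal eventually, and one proceeds from the last row to the first (\<open>iteration_diagonalizes\<close>).

  Correctness is the invariant that $UMV$ equals $M^{(i)}$ for even $i$ and
  $\widetilde\theta(M^{(i)})$ for odd $i$ (\<open>diag_transforms\<close>).\<close>

section \<open>Degree and division in an Ore extension of a skew field\<close>

lemma ore_eval_upto:
  assumes "degree p \<le> n"
  shows "ore_eval D p = (\<Sum>k\<le>n. coeff p k * D ^ k)"
  unfolding ore_eval_def using assms
  by (intro sum.mono_neutral_left) (auto simp: coeff_eq_0)

lemma ore_eval_add: "ore_eval D (p + q) = ore_eval D p + ore_eval D q"
proof -
  let ?n = "max (degree p) (degree q)"
  have "degree (p + q) \<le> ?n" by (rule degree_add_le_max)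
  then show ?thesis
    by (simp add: ore_eval_upto[of _ ?n] distrib_right sum.distrib)
qed

locale ore_ring =
  fixes A :: "'r::ring_1 set" and D :: 'r and \<sigma> \<delta> :: "'r \<Rightarrow> 'r"
  assumes ore: "ore_extension UNIV A D \<sigma> \<delta>"
    and A_inverse: "\<lbrakk>a \<in> A; a \<noteq> 0\<rbrakk> \<Longrightarrow> \<exists>b\<in>A. a * b = 1 \<and> b * a = 1"
    and \<sigma>_inj: "inj_on \<sigma> A"
begin

abbreviation cf :: "'r \<Rightarrow> nat \<Rightarrow> 'r" where "cf \<equiv> ore_coeff A D"

definition pol :: "'r \<Rightarrow> 'r poly" where "pol = the_inv_into (polys_over A) (ore_eval D)"

definition deg :: "'r \<Rightarrow> nat" where "deg r = degree (pol r)"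

lemma A_one: "1 \<in> A" and A_diff: "\<lbrakk>a \<in> A; b \<in> A\<rbrakk> \<Longrightarrow> a - b \<in> A"
  and A_mult: "\<lbrakk>a \<in> A; b \<in> A\<rbrakk> \<Longrightarrow> a * b \<in> A"
  using ore unfolding ore_extension_def subring_of_def by auto

lemma A_zero: "0 \<in> A"
  using A_diff[OF A_one A_one] by simp

lemma A_add: "\<lbrakk>a \<in> A; b \<in> A\<rbrakk> \<Longrightarrow> a + b \<in> A"
  using A_diff[of a "0 - b"] A_diff[of 0 b] A_zero by simp

lemma \<sigma>_in: "a \<in> A \<Longrightarrow> \<sigma> a \<in> A" and \<delta>_in: "a \<in> A \<Longrightarrow> \<delta> a \<in> A" and \<sigma>_one: "\<sigma> 1 = 1"
  and D_mult: "a \<in> A \<Longrightarrow> D * a = \<sigma> a * D + \<delta> a"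
  using ore unfolding ore_extension_def by auto

lemma \<sigma>_zero: "\<sigma> 0 = 0" and \<delta>_zero: "\<delta> 0 = 0"
proof -
  have "\<sigma> (0 + 0) = \<sigma> 0 + \<sigma> 0" "\<delta> (0 + 0) = \<delta> 0 + \<delta> 0"
    using ore A_zero unfolding ore_extension_def by blast+
  then show "\<sigma> 0 = 0" "\<delta> 0 = 0" by simp_all
qed

lemma \<sigma>_eq_0_iff: "a \<in> A \<Longrightarrow> \<sigma> a = 0 \<longleftrightarrow> a = 0"
  using \<sigma>_inj A_zero \<sigma>_zero by (metis inj_onD)

lemma A_no_zero_divisors:
  assumes "a \<in> A" "b \<in> A" "a * b = 0" shows "a = 0 \<or> b = 0"
proof (rule ccontr)
  assume "\<not> ?thesis"
  then obtain c where "c * a = 1" using A_inverse assms by blast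
  then have "b = c * (a * b)" by (metis mult.assoc mult_1)
  with assms \<open>\<not> ?thesis\<close> show False by simp
qed

lemma eval_bij: "bij_betw (ore_eval D) (polys_over A) UNIV"
  using ore unfolding ore_extension_def by blast

lemma pol_in: "pol r \<in> polys_over A"
  unfolding pol_def using eval_bij
  by (metis UNIV_I bij_betw_def subset_refl the_inv_into_into)

lemma eval_pol: "ore_eval D (pol r) = r"
  unfolding pol_def using eval_bij by (metis UNIV_I f_the_inv_into_f_bij_betw)

lemma pol_eval: "p \<in> polys_over A \<Longrightarrow> pol (ore_eval D p) = p"
  unfolding pol_def using eval_bij by (metis bij_betw_def the_inv_into_f_f)

lemma cf_pol: "cf r k = coeff (pol r) k"
  by (simp add: ore_coeff_def pol_def)

lemma cf_in: "cf r k \<in> A"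
  using pol_in by (simp add: cf_pol polys_over_def)

lemma cf_add: "cf (r + s) k = cf r k + cf s k"
proof -
  have "pol r + pol s \<in> polys_over A"
    using pol_in[of r] pol_in[of s] by (auto simp: polys_over_def A_add)
  then have "pol (r + s) = pol r + pol s"
    by (metis pol_eval ore_eval_add eval_pol)
  then show ?thesis by (simp add: cf_pol)
qed

lemma cf_0 [simp]: "cf 0 k = 0"
  using cf_add[of 0 0] by simp

lemma cf_diff: "cf (r - s) k = cf r k - cf s k"
  using cf_add[of "r - s" s k] by (simp add: algebra_simps)

lemma cf_sum: "cf (sum f I) k = (\<Sum>i\<in>I. cf (f i) k)"
  by (induction I rule: infinite_finite_induct) (auto simp: cf_add)

lemma cf_const_mult:
  assumes "a \<in> A" shows "cf (a * r) k = a * cf r k"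
proof -
  let ?p = "map_poly ((*) a) (pol r)"
  have c: "coeff ?p k = a * coeff (pol r) k" for k by (simp add: coeff_map_poly)
  have "degree ?p \<le> degree (pol r)" by (rule degree_le) (auto simp: c coeff_eq_0)
  then have "ore_eval D ?p = a * ore_eval D (pol r)"
    by (simp add: ore_eval_upto[of _ "degree (pol r)"] c sum_distrib_left mult.assoc)
  moreover have "?p \<in> polys_over A" using pol_in[of r] assms by (auto simp: polys_over_def c A_mult)
  ultimately have "pol (a * r) = ?p" by (metis pol_eval eval_pol)
  then show ?thesis by (simp add: cf_pol c)
qed

lemma cf_D_mult: "cf (D * r) k = (if k = 0 then 0 else \<sigma> (cf r (k - 1))) + \<delta> (cf r k)"
proof -
  let ?s = "pCons 0 (map_poly \<sigma> (pol r))" and ?d = "map_poly \<delta> (pol r)"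
  let ?n = "degree (pol r)"
  have cs: "coeff ?s k = (if k = 0 then 0 else \<sigma> (coeff (pol r) (k - 1)))" for k
    by (cases k) (auto simp: coeff_map_poly \<sigma>_zero)
  have cd: "coeff ?d k = \<delta> (coeff (pol r) k)" for k by (simp add: coeff_map_poly \<delta>_zero)
  have ds: "degree ?s \<le> Suc ?n"
    by (rule degree_le) (auto simp: cs \<sigma>_zero coeff_eq_0)
  have dd: "degree ?d \<le> ?n" by (rule degree_le) (auto simp: cd \<delta>_zero coeff_eq_0)
  have in_A: "coeff (pol r) k \<in> A" for k using pol_in[of r] by (simp add: polys_over_def)
  have "D * r = D * (\<Sum>k\<le>?n. coeff (pol r) k * D ^ k)"
    using eval_pol[of r] by (simp add: ore_eval_def)
  also have "\<dots> = (\<Sum>k\<le>?n. \<sigma> (coeff (pol r) k) * D ^ Suc k) + (\<Sum>k\<le>?n. \<delta> (coeff (pol r) k) * D ^ k)"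
    by (simp add: sum_distrib_left mult.assoc[symmetric] D_mult[OF in_A] distrib_right sum.distrib)
  also have "\<dots> = ore_eval D ?s + ore_eval D ?d"
    by (simp add: ore_eval_upto[OF ds] ore_eval_upto[OF dd] cs cd sum.atMost_Suc_shift
      del: sum.atMost_Suc power_Suc)
  also have "\<dots> = ore_eval D (?s + ?d)" by (simp add: ore_eval_add)
  finally have "D * r = ore_eval D (?s + ?d)" .
  moreover have "?s + ?d \<in> polys_over A"
    by (auto simp: polys_over_def cs cd in_A \<sigma>_in \<delta>_in A_add A_zero simp del: coeff_pCons)
  ultimately have "pol (D * r) = ?s + ?d" by (metis pol_eval)
  then show ?thesis by (simp add: cf_pol cs cd del: coeff_pCons)
qed

lemma cf_above_deg: "deg r < k \<Longrightarrow> cf r k = 0"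
  by (simp add: cf_pol deg_def coeff_eq_0)

lemma cf_deg_eq_0_iff: "cf r (deg r) = 0 \<longleftrightarrow> r = 0"
proof
  assume "cf r (deg r) = 0"
  then have "pol r = 0" by (simp add: cf_pol deg_def)
  then have "ore_eval D 0 = r" using eval_pol[of r] by simp
  then show "r = 0" by (simp add: ore_eval_def)
qed simp

lemma deg_eqI: "\<lbrakk>cf r n \<noteq> 0; \<And>k. k > n \<Longrightarrow> cf r k = 0\<rbrakk> \<Longrightarrow> deg r = n"
  by (metis cf_above_deg cf_deg_eq_0_iff cf_0 linorder_neqE_nat)

lemma deg_lessI: "\<lbrakk>r \<noteq> 0; \<And>k. k \<ge> n \<Longrightarrow> cf r k = 0\<rbrakk> \<Longrightarrow> deg r < n"
  by (metis cf_deg_eq_0_iff not_less)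

lemma ore_expansion: "r = (\<Sum>k\<le>deg r. cf r k * D ^ k)"
  using eval_pol[of r] by (simp add: ore_eval_def deg_def cf_pol)

text \<open>Multiplication by $\partial$ twists coefficients by $\sigma$ and adds terms $\delta(c)$
  of lower order, so the leading coefficient of $\partial^n r$ is that of $r$ twisted $n$ times.\<close>

lemma cf_D_power_mult:
  "(\<forall>k>n + deg r. cf (D ^ n * r) k = 0) \<and> cf (D ^ n * r) (n + deg r) = (\<sigma> ^^ n) (cf r (deg r))"
proof (induction n)
  case 0 then show ?case by (simp add: cf_above_deg)
next
  case (Suc n)
  then show ?case by (auto simp: mult.assoc cf_D_mult \<sigma>_zero \<delta>_zero)
qed

lemma \<sigma>_power: "a \<in> A \<Longrightarrow> (\<sigma> ^^ n) a \<in> A \<and> ((\<sigma> ^^ n) a = 0 \<longleftrightarrow> a = 0)"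
  by (induction n) (auto simp: \<sigma>_in \<sigma>_eq_0_iff)

text \<open>The top coefficient of $rs$ is $a\,\sigma^n(b)$ with $a,b$ the top coefficients of $r,s$ and
  $n=\deg r$; it does not vanish since $\sigma$ is injective and $A$ is a skew field.\<close>

lemma deg_mult:
  assumes "r \<noteq> 0" "s \<noteq> 0"
  shows "r * s \<noteq> 0" and "deg (r * s) = deg r + deg s"
proof -
  let ?n = "deg r" and ?m = "deg s"
  have expand: "cf (r * s) k = (\<Sum>i\<le>?n. cf r i * cf (D ^ i * s) k)" for k
    by (subst ore_expansion[of r])
       (simp add: sum_distrib_right mult.assoc cf_sum cf_const_mult[OF cf_in])
  have above: "cf (r * s) k = 0" if "k > ?n + ?m" for k
    unfolding expand using cf_D_power_mult[of _ s] that by (intro sum.neutral) auto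
  have "cf (r * s) (?n + ?m) = (\<Sum>i\<in>{?n}. cf r i * cf (D ^ i * s) (?n + ?m))"
    unfolding expand using cf_D_power_mult[of _ s]
    by (intro sum.mono_neutral_right) auto
  then have "cf (r * s) (?n + ?m) = cf r ?n * (\<sigma> ^^ ?n) (cf s ?m)"
    using cf_D_power_mult[of ?n s] by simp
  then have lead: "cf (r * s) (?n + ?m) \<noteq> 0"
    using A_no_zero_divisors[of "cf r ?n" "(\<sigma> ^^ ?n) (cf s ?m)"] assms \<sigma>_power[OF cf_in[of s ?m], of ?n] cf_in
    by (auto simp: cf_deg_eq_0_iff)
  then show "r * s \<noteq> 0" by auto
  show "deg (r * s) = ?n + ?m" using lead above by (rule deg_eqI)
qed

lemma cf_const: "a \<in> A \<Longrightarrow> cf a k = (if k = 0 then a else 0)"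
proof -
  assume a: "a \<in> A"
  have "[:a:] \<in> polys_over A" using a A_zero by (auto simp: polys_over_def coeff_pCons split: nat.split)
  moreover have "ore_eval D [:a:] = a" by (simp add: ore_eval_def)
  ultimately have "pol a = [:a:]" by (metis pol_eval)
  then show ?thesis by (simp add: cf_pol coeff_pCons split: nat.split)
qed

lemma deg_eq_0_iff: "deg r = 0 \<longleftrightarrow> r \<in> A"
proof
  assume "deg r = 0"
  then have "r = cf r 0" using ore_expansion[of r] by simp
  then show "r \<in> A" using cf_in by metis
next
  assume "r \<in> A"
  then show "deg r = 0"
    by (metis cf_const cf_deg_eq_0_iff deg_def degree_0 eval_pol pol_def cf_pol leading_coeff_0_iff)
qed

text \<open>Degrees of a product add up, so units have degree 0. This is the reason why an involution
  respects $A$.\<close>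

lemma unit_in_A: "r * s = 1 \<Longrightarrow> r \<in> A"
  using deg_mult[of r s] deg_eq_0_iff[of 1] deg_eq_0_iff[of r] A_one
  by (metis add_eq_0_iff_both_eq_0 mult_zero_left mult_zero_right zero_neq_one)

lemma deg_add_dominant:
  assumes "r \<noteq> 0" "s = 0 \<or> deg s < deg r"
  shows "deg (r + s) = deg r"
  using assms by (intro deg_eqI) (auto simp: cf_add cf_above_deg cf_deg_eq_0_iff)

lemma cf_D: "cf D k = (if k = 1 then 1 else 0)"
proof -
  have "\<delta> 1 = 0" using D_mult[OF A_one] by (simp add: \<sigma>_one)
  then show ?thesis
    using cf_D_mult[of 1 k] by (auto simp: cf_const[OF A_one] \<sigma>_one \<sigma>_zero \<delta>_zero)
qed

definition monic :: "'r \<Rightarrow> bool" where "monic r \<longleftrightarrow> cf r (deg r) = 1"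

lemma monic_nonzero: "monic r \<Longrightarrow> r \<noteq> 0"
  by (auto simp: monic_def)

lemma make_monic:
  assumes "r \<noteq> 0" obtains a where "a \<in> A" "a \<noteq> 0" "monic (a * r)" "deg (a * r) = deg r"
proof -
  obtain a where a: "a \<in> A" "a * cf r (deg r) = 1"
    using A_inverse[OF cf_in] assms by (metis cf_deg_eq_0_iff)
  then have "a \<noteq> 0" by auto
  moreover from this have "deg (a * r) = deg r"
    using deg_mult(2)[of a r] a assms deg_eq_0_iff[of a] by simp
  ultimately show ?thesis using that a by (simp add: monic_def cf_const_mult)
qed

text \<open>Euclidean division of $f$ by $h$ with the quotient on the left. The remainder is described by
  vanishing coefficients instead of a smaller degree, which covers the zero remainder and is the form
  in which reducedness of a Groebner basis appears.\<close>

lemma right_division: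
  assumes h: "monic h"
  obtains q where "\<And>k. k \<ge> deg h \<Longrightarrow> cf (f - q * h) k = 0"
proof -
  have "\<exists>q. \<forall>k\<ge>deg h. cf (f - q * h) k = 0" if "\<And>k. k \<ge> n \<Longrightarrow> cf f k = 0" for n
    using that
  proof (induction n arbitrary: f)
    case 0
    then show ?case by (intro exI[of _ 0]) simp
  next
    case (Suc m)
    show ?case
    proof (cases "deg h \<le> m")
      case False
      then show ?thesis using Suc.prems by (intro exI[of _ 0]) simp
    next
      case True
      \<comment> \<open>$\partial^{m-\deg h}h$ is again monic because $\sigma(1)=1$, so no twist has to be undone.\<close>
      let ?q = "cf f m * D ^ (m - deg h)"
      have one: "(\<sigma> ^^ n) 1 = 1" for n by (induction n) (auto simp: \<sigma>_one)
      have "cf (f - ?q * h) k = 0" if "k \<ge> m" for k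
        using cf_D_power_mult[of "m - deg h" h] True that Suc.prems[of k] h
        by (cases "k = m") (auto simp: cf_diff mult.assoc cf_const_mult[OF cf_in] one monic_def)
      then obtain q where "\<forall>k\<ge>deg h. cf (f - ?q * h - q * h) k = 0"
        using Suc.IH by blast
      then show ?thesis
        by (intro exI[of _ "?q + q"]) (simp add: distrib_right diff_diff_eq)
    qed
  qed
  from this[of "Suc (deg f)"] that show ?thesis by (auto simp: cf_above_deg)
qed

end

section \<open>Leading positions and reduction of row vectors\<close>

text \<open>The position-over-term order compares positions first, so the leading monomial of $f$ sits in
  the last nonzero entry of $f$.\<close>

definition leads :: "'r::zero vec \<Rightarrow> nat \<Rightarrow> bool" where
  "leads f p \<longleftrightarrow> p < dim_vec f \<and> f $ p \<noteq> 0 \<and> (\<forall>j. p < j \<and> j < dim_vec f \<longrightarrow> f $ j = 0)"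

lemma leads_exists:
  assumes "f \<in> carrier_vec q" "f \<noteq> 0\<^sub>v q"
  obtains p where "leads f p"
proof -
  let ?S = "{j. j < q \<and> f $ j \<noteq> 0}"
  have "?S \<noteq> {}" using assms by (auto intro!: eq_vecI)
  then obtain p where p: "p \<in> ?S" "\<forall>j\<in>?S. j \<le> p"
    using Max_in[of ?S] Max_ge[of ?S] finite_subset[of ?S "{..<q}"] by blast
  then have "leads f p" using assms(1) by (auto simp: leads_def dest: leD)
  then show ?thesis by (rule that)
qed

lemma leads_unique: "leads f p \<Longrightarrow> leads f p' \<Longrightarrow> p = p'"
  unfolding leads_def by (metis linorder_neqE_nat)

lemma leads_nonzero: "leads f p \<Longrightarrow> f \<noteq> 0\<^sub>v q"
  by (auto simp: leads_def)

definition left_submodule :: "nat \<Rightarrow> 'r::ring_1 vec set \<Rightarrow> bool" where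
  "left_submodule q L \<longleftrightarrow> L \<subseteq> carrier_vec q \<and> 0\<^sub>v q \<in> L \<and>
     (\<forall>f\<in>L. \<forall>h\<in>L. f + h \<in> L) \<and> (\<forall>r. \<forall>f\<in>L. r \<cdot>\<^sub>v f \<in> L)"

lemma left_submoduleD:
  assumes "left_submodule q L"
  shows "f \<in> L \<Longrightarrow> f \<in> carrier_vec q" and "0\<^sub>v q \<in> L"
    and "\<lbrakk>f \<in> L; h \<in> L\<rbrakk> \<Longrightarrow> f + h \<in> L" and "f \<in> L \<Longrightarrow> r \<cdot>\<^sub>v f \<in> L"
  using assms by (auto simp: left_submodule_def)

lemma left_submodule_diff:
  assumes L: "left_submodule q L" and f: "f \<in> L" and h: "h \<in> L"
  shows "f - h \<in> L"
proof -
  have "f + (-1) \<cdot>\<^sub>v h \<in> L" using left_submoduleD[OF L] f h by blast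
  moreover have "f + (-1) \<cdot>\<^sub>v h = f - h"
    using left_submoduleD(1)[OF L] f h by (intro eq_vecI) auto
  ultimately show ?thesis by simp
qed

lemma row_module_iff:
  assumes "N \<in> carrier_mat m q"
  shows "f \<in> row_module N \<longleftrightarrow> f \<in> carrier_vec q \<and> (\<exists>r. \<forall>j<q. f $ j = (\<Sum>i<m. r i * N $$ (i, j)))"
    (is "?l \<longleftrightarrow> ?r")
proof
  assume ?l then show ?r using assms by (auto simp: row_module_def)
next
  assume ?r
  then obtain r where "f \<in> carrier_vec q" "\<forall>j<q. f $ j = (\<Sum>i<m. r i * N $$ (i, j))" by blast
  then have "f = vec q (\<lambda>j. \<Sum>i<m. r i * N $$ (i, j))" by (intro eq_vecI) auto
  then show ?l using assms by (auto simp: row_module_def)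
qed

lemma row_module_submodule:
  assumes "N \<in> carrier_mat m q"
  shows "left_submodule q (row_module N)"
  unfolding left_submodule_def
proof (intro conjI ballI allI)
  show "row_module N \<subseteq> carrier_vec q" using assms by (auto simp: row_module_iff)
  show "0\<^sub>v q \<in> row_module N"
    by (auto simp: row_module_iff[OF assms] intro!: exI[of _ "\<lambda>_. 0"])
next
  fix f h assume "f \<in> row_module N" "h \<in> row_module N"
  then obtain r s where f: "f \<in> carrier_vec q" "\<forall>j<q. f $ j = (\<Sum>i<m. r i * N $$ (i, j))"
    and h: "h \<in> carrier_vec q" "\<forall>j<q. h $ j = (\<Sum>i<m. s i * N $$ (i, j))"
    unfolding row_module_iff[OF assms] by blast
  then have "\<forall>j<q. (f + h) $ j = (\<Sum>i<m. (r i + s i) * N $$ (i, j))"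
    by (simp add: distrib_right sum.distrib)
  then show "f + h \<in> row_module N" using f h unfolding row_module_iff[OF assms] 
    by (intro conjI exI[of _ "\<lambda>i. r i + s i"]) auto
next
  fix a f assume "f \<in> row_module N"
  then obtain r where f: "f \<in> carrier_vec q" "\<forall>j<q. f $ j = (\<Sum>i<m. r i * N $$ (i, j))"
    unfolding row_module_iff[OF assms] by blast
  then have "\<forall>j<q. (a \<cdot>\<^sub>v f) $ j = (\<Sum>i<m. (a * r i) * N $$ (i, j))"
    by (simp add: sum_distrib_left mult.assoc)
  then show "a \<cdot>\<^sub>v f \<in> row_module N" using f unfolding row_module_iff[OF assms]
    by (intro conjI exI[of _ "\<lambda>i. a * r i"]) auto
qed

lemma row_in_row_module:
  assumes "N \<in> carrier_mat m q" "i < m"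
  shows "row N i \<in> row_module N"
proof -
  have "\<forall>j<q. row N i $ j = (\<Sum>k<m. (if k = i then 1 else 0) * N $$ (k, j))"
    using assms by (simp add: if_distrib[of "\<lambda>x. x * _"] cong: if_cong)
  moreover have "row N i \<in> carrier_vec q" using assms(1) by auto
  ultimately show ?thesis unfolding row_module_iff[OF assms(1)] by (intro conjI exI)
qed

text \<open>The sum of multiples of rows is built up one row at a time, which turns closure under the two
  module operations into closure under combinations of all rows.\<close>

lemma row_module_least:
  assumes E: "E \<in> carrier_mat m q" and L: "left_submodule q L" and rows: "\<And>i. i < m \<Longrightarrow> row E i \<in> L"
  shows "row_module E \<subseteq> L"
proof
  fix f assume "f \<in> row_module E"
  then obtain r where f: "f \<in> carrier_vec q" "\<forall>j<q. f $ j = (\<Sum>i<m. r i * E $$ (i, j))"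
    unfolding row_module_iff[OF E] by blast
  have "vec q (\<lambda>j. \<Sum>i<k. r i * E $$ (i, j)) \<in> L" if "k \<le> m" for k
    using that
  proof (induction k)
    case 0
    have "vec q (\<lambda>j. \<Sum>i<0. r i * E $$ (i, j)) = 0\<^sub>v q" by (intro eq_vecI) auto
    then show ?case using left_submoduleD(2)[OF L] by simp
  next
    case (Suc k)
    have "vec q (\<lambda>j. \<Sum>i<Suc k. r i * E $$ (i, j)) = vec q (\<lambda>j. \<Sum>i<k. r i * E $$ (i, j)) + r k \<cdot>\<^sub>v row E k"
      using E Suc.prems by (intro eq_vecI) auto
    then show ?case using Suc rows left_submoduleD(3,4)[OF L] by simp
  qed
  from this[of m] have "vec q (\<lambda>j. \<Sum>i<m. r i * E $$ (i, j)) \<in> L" by simp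
  moreover have "vec q (\<lambda>j. \<Sum>i<m. r i * E $$ (i, j)) = f" using f by (intro eq_vecI) auto
  ultimately show "f \<in> L" by simp
qed

lemma rows_in_row_module:
  assumes N: "N \<in> carrier_mat m q" and H: "H \<in> carrier_mat k q"
    and rows: "\<And>i. i < k \<Longrightarrow> row H i \<in> row_module N"
  obtains W where "W \<in> carrier_mat k m" "W * N = H"
proof -
  have "\<exists>r. \<forall>j<q. row H i $ j = (\<Sum>l<m. r l * N $$ (l, j))" if "i < k" for i
    using rows[OF that] unfolding row_module_iff[OF N] by blast
  then have "\<forall>i. \<exists>r. i < k \<longrightarrow> (\<forall>j<q. row H i $ j = (\<Sum>l<m. r l * N $$ (l, j)))"
    by blast
  then obtain r where r: "\<And>i j. \<lbrakk>i < k; j < q\<rbrakk> \<Longrightarrow> row H i $ j = (\<Sum>l<m. r i l * N $$ (l, j))"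
    by (subst (asm) choice_iff) blast
  let ?W = "mat k m (\<lambda>(i, l). r i l)"
  have "?W * N = H"
  proof (rule eq_matI)
    fix i j assume "i < dim_row H" "j < dim_col H"
    then have "i < k" "j < q" using H by auto
    then show "(?W * N) $$ (i, j) = H $$ (i, j)"
      using r[of i j] N H by (simp add: scalar_prod_def lessThan_atLeast0)
  qed (use N H in auto)
  then show ?thesis using that[of ?W] by simp
qed

context ore_ring
begin

text \<open>With this, leading monomials reduce to leading positions and degrees of single entries.\<close>

lemma lm_eq:
  assumes "leads f p"
  shows "lm A D f = (p, deg (f $ p))"
  unfolding lm_def greatest_wrt_def
proof (rule the_equality)
  have top: "(p, deg (f $ p)) \<in> monomials_of A D f"
    using assms by (auto simp: monomials_of_def leads_def cf_deg_eq_0_iff)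
  have less: "mon_less t (p, deg (f $ p))" if "t \<in> monomials_of A D f" "t \<noteq> (p, deg (f $ p))" for t
  proof -
    obtain i k where t: "t = (i, k)" by force
    then have i: "i < dim_vec f" "cf (f $ i) k \<noteq> 0" using that by (auto simp: monomials_of_def)
    then have "i \<le> p" "k \<le> deg (f $ i)"
      using assms cf_above_deg[of "f $ i" k] unfolding leads_def by (metis not_less cf_0)+
    then show ?thesis using t that(2) by (auto simp: mon_less_def)
  qed
  show "(p, deg (f $ p)) \<in> monomials_of A D f \<and>
      (\<forall>m'\<in>monomials_of A D f. m' \<noteq> (p, deg (f $ p)) \<longrightarrow> mon_less m' (p, deg (f $ p)))"
    using top less by blast
  fix m
  assume m: "m \<in> monomials_of A D f \<and> (\<forall>m'\<in>monomials_of A D f. m' \<noteq> m \<longrightarrow> mon_less m' m)"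
  show "m = (p, deg (f $ p))"
  proof (rule ccontr)
    assume "m \<noteq> (p, deg (f $ p))"
    then have "mon_less m (p, deg (f $ p))" "mon_less (p, deg (f $ p)) m"
      using m top less by (blast, metis)
    then show False by (auto simp: mon_less_def)
  qed
qed

lemma lc_eq: "leads f p \<Longrightarrow> lc A D f = cf (f $ p) (deg (f $ p))"
  by (simp add: lc_def lm_eq)

text \<open>Division with remainder by a family of vectors with distinct leading positions. Subtracting a
  multiple of \<open>F b\<close> changes only entries up to position \<open>b\<close>; hence the entries
  are reduced from the last to the first, and a reduced entry is never touched again.\<close>

lemma reduce_vector:
  assumes S: "left_submodule q S" and P: "P \<subseteq> {..<q}"
    and F: "\<And>p. p \<in> P \<Longrightarrow> F p \<in> S \<and> leads (F p) p \<and> monic (F p $ p)"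
    and f: "f \<in> carrier_vec q" and b: "b \<le> q"
  obtains f' where "f' \<in> carrier_vec q" "f - f' \<in> S"
    "\<And>j. \<lbrakk>b \<le> j; j < q\<rbrakk> \<Longrightarrow> f' $ j = f $ j"
    "\<And>p k. \<lbrakk>p \<in> P; p < b; deg (F p $ p) \<le> k\<rbrakk> \<Longrightarrow> cf (f' $ p) k = 0"
proof -
  have "\<exists>f'. f' \<in> carrier_vec q \<and> f - f' \<in> S \<and> (\<forall>j. b \<le> j \<and> j < q \<longrightarrow> f' $ j = f $ j) \<and>
      (\<forall>p k. p \<in> P \<and> p < b \<and> deg (F p $ p) \<le> k \<longrightarrow> cf (f' $ p) k = 0)"
    using f b
  proof (induction b arbitrary: f)
    case 0
    then have "f - f = 0\<^sub>v q" by auto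
    then have "f - f \<in> S" using left_submoduleD(2)[OF S] by simp
    then show ?case using 0(1) by blast
  next
    case (Suc b)
    show ?case
    proof (cases "b \<in> P")
      case False
      obtain f' where "f' \<in> carrier_vec q" "f - f' \<in> S" "\<forall>j. b \<le> j \<and> j < q \<longrightarrow> f' $ j = f $ j"
        "\<forall>p k. p \<in> P \<and> p < b \<and> deg (F p $ p) \<le> k \<longrightarrow> cf (f' $ p) k = 0"
        using Suc.IH[OF Suc.prems(1) Suc_leD[OF Suc.prems(2)]] by blast
      then show ?thesis using False by (intro exI[of _ f']) (auto simp: less_Suc_eq)
    next
      case True
      note Fb = F[OF True]
      have Fc: "F b \<in> carrier_vec q" using Fb left_submoduleD(1)[OF S] by blast
      obtain r where r: "\<And>k. k \<ge> deg (F b $ b) \<Longrightarrow> cf (f $ b - r * F b $ b) k = 0"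
        using right_division Fb by metis
      let ?f = "f - r \<cdot>\<^sub>v F b"
      have fc: "?f \<in> carrier_vec q" using Suc.prems(1) Fc by simp
      obtain f' where f': "f' \<in> carrier_vec q" "?f - f' \<in> S" "\<forall>j. b \<le> j \<and> j < q \<longrightarrow> f' $ j = ?f $ j"
        "\<forall>p k. p \<in> P \<and> p < b \<and> deg (F p $ p) \<le> k \<longrightarrow> cf (f' $ p) k = 0"
        using Suc.IH[OF fc Suc_leD[OF Suc.prems(2)]] by blast
      have "f - f' = (?f - f') + r \<cdot>\<^sub>v F b"
        using f'(1) Fc Suc.prems(1) by (intro eq_vecI) auto
      then have "f - f' \<in> S" using f'(2) Fb left_submoduleD[OF S] by metis
      moreover have "f' $ j = f $ j" if "Suc b \<le> j" "j < q" for j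
        using f'(3) that Fb Fc Suc.prems(1) by (auto simp: leads_def)
      moreover have "cf (f' $ p) k = 0" if "p \<in> P" "p < Suc b" "deg (F p $ p) \<le> k" for p k
        using that f'(3,4) r Fc Suc.prems by (cases "p = b") auto
      ultimately show ?thesis using f'(1) by blast
    qed
  qed
  then show ?thesis using that by blast
qed

definition minimal_at :: "'r vec set \<Rightarrow> nat \<Rightarrow> 'r \<Rightarrow> bool" where
  "minimal_at L p r \<longleftrightarrow> (\<forall>f\<in>L. leads f p \<longrightarrow> deg r \<le> deg (f $ p))"

lemma minimal_leader:
  assumes L: "left_submodule q L" and f: "f \<in> L" "leads f p"
  obtains h where "h \<in> L" "leads h p" "monic (h $ p)" "minimal_at L p (h $ p)"
proof -
  obtain h where h: "h \<in> L" "leads h p" "\<And>u. u \<in> L \<Longrightarrow> leads u p \<Longrightarrow> deg (h $ p) \<le> deg (u $ p)"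
    using ex_has_least_nat[of "\<lambda>h. h \<in> L \<and> leads h p" f "\<lambda>h. deg (h $ p)"] f by blast
  have "h $ p \<noteq> 0" "p < dim_vec h" using h by (auto simp: leads_def)
  then obtain a where a: "a \<noteq> 0" "monic (a * h $ p)" "deg (a * h $ p) = deg (h $ p)"
    using make_monic by metis
  show ?thesis
  proof (rule that)
    show "a \<cdot>\<^sub>v h \<in> L" using h left_submoduleD[OF L] by blast
    show "leads (a \<cdot>\<^sub>v h) p" using h(2) a monic_nonzero by (auto simp: leads_def)
    show "monic ((a \<cdot>\<^sub>v h) $ p)" using a \<open>p < dim_vec h\<close> by simp
    show "minimal_at L p ((a \<cdot>\<^sub>v h) $ p)" using a h(3) \<open>p < dim_vec h\<close> by (simp add: minimal_at_def)
  qed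
qed

text \<open>A remainder in \<open>L\<close> would have a leading entry whose degree is below the minimum for
  its position, so the remainder is zero. Two uses: few leading positions would mean few generators, and
  a Hermite form generates the module it belongs to.\<close>

lemma minimal_leaders_generate:
  assumes L: "left_submodule q L" and S: "left_submodule q S" and sub: "S \<subseteq> L"
    and F: "\<And>p. p \<in> P \<Longrightarrow> F p \<in> S \<and> leads (F p) p \<and> monic (F p $ p) \<and> minimal_at L p (F p $ p)"
    and P: "\<And>f p. f \<in> L \<Longrightarrow> leads f p \<Longrightarrow> p \<in> P" and Pq: "P \<subseteq> {..<q}"
    and f: "f \<in> L"
  shows "f \<in> S"
proof -
  have fc: "f \<in> carrier_vec q" using f left_submoduleD[OF L] by blast
  obtain f' where f': "f' \<in> carrier_vec q" "f - f' \<in> S"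
    "\<And>p k. \<lbrakk>p \<in> P; p < q; deg (F p $ p) \<le> k\<rbrakk> \<Longrightarrow> cf (f' $ p) k = 0"
    using reduce_vector[OF S Pq _ fc order_refl, of F] F by metis
  have "f - (f - f') = f'" using fc f' by (intro eq_vecI) auto
  then have f'L: "f' \<in> L" using left_submodule_diff[OF L f, of "f - f'"] f'(2) sub by auto
  have "f' = 0\<^sub>v q"
  proof (rule ccontr)
    assume "f' \<noteq> 0\<^sub>v q"
    then obtain p where p: "leads f' p" using leads_exists f'(1) by blast
    then have "p \<in> P" using P f'L by blast
    then have "deg (F p $ p) \<le> deg (f' $ p)" using F p f'L by (auto simp: minimal_at_def)
    then have "cf (f' $ p) (deg (f' $ p)) = 0" using f'(3) \<open>p \<in> P\<close> Pq by auto
    then show False using p by (simp add: cf_deg_eq_0_iff leads_def)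
  qed
  then have "f - f' = f" using fc by auto
  then show ?thesis using f' by simp
qed

section \<open>Hermite forms\<close>

text \<open>This is the reduced Groebner basis of a module having leading monomials in all \<open>q\<close>
  positions, written in terms of matrix entries; condition \<open>leads (row H p) p\<close> is lower
  triangularity. Vanishing coefficients from the degree of $H_{jj}$ on express that $H_{pj}$ is zero
  or of smaller degree.\<close>

definition hermite_form :: "nat \<Rightarrow> 'r vec set \<Rightarrow> 'r mat \<Rightarrow> bool" where
  "hermite_form q L H \<longleftrightarrow> H \<in> carrier_mat q q \<and>
     (\<forall>p<q. row H p \<in> L \<and> leads (row H p) p \<and> monic (H $$ (p, p)) \<and> minimal_at L p (H $$ (p, p)) \<and>
       (\<forall>j<p. \<forall>k\<ge>deg (H $$ (j, j)). cf (H $$ (p, j)) k = 0))"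

text \<open>Choose a monic vector of least degree for each leading position and reduce it by those of the
  earlier positions; this leaves its leading entry unchanged.\<close>

lemma hermite_form_exists:
  assumes L: "left_submodule q L" and full: "\<And>p. p < q \<Longrightarrow> \<exists>f\<in>L. leads f p"
  obtains H where "hermite_form q L H"
proof -
  have "\<exists>h. h \<in> L \<and> leads h p \<and> monic (h $ p) \<and> minimal_at L p (h $ p)" if "p < q" for p
    using full[OF that] minimal_leader[OF L] by metis
  then obtain F where F: "\<And>p. p < q \<Longrightarrow> F p \<in> L \<and> leads (F p) p \<and> monic (F p $ p) \<and> minimal_at L p (F p $ p)"
    by metis
  have "\<exists>h. h \<in> carrier_vec q \<and> F p - h \<in> L \<and> (\<forall>j. p \<le> j \<and> j < q \<longrightarrow> h $ j = F p $ j) \<and>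
      (\<forall>j<p. \<forall>k\<ge>deg (F j $ j). cf (h $ j) k = 0)" if p: "p < q" for p
  proof -
    have "F p \<in> carrier_vec q" using F[OF p] left_submoduleD(1)[OF L] by blast
    moreover have "F j \<in> L \<and> leads (F j) j \<and> monic (F j $ j)" if "j \<in> {..<q}" for j
      using F that by blast
    ultimately obtain h where h: "h \<in> carrier_vec q" "F p - h \<in> L" "\<And>j. \<lbrakk>p \<le> j; j < q\<rbrakk> \<Longrightarrow> h $ j = F p $ j"
      "\<And>j k. \<lbrakk>j \<in> {..<q}; j < p; deg (F j $ j) \<le> k\<rbrakk> \<Longrightarrow> cf (h $ j) k = 0"
      using reduce_vector[OF L subset_refl, of F "F p" p] p by (metis less_imp_le)
    then show ?thesis using p by (intro exI[of _ h]) auto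
  qed
  then obtain h where h: "\<And>p. p < q \<Longrightarrow> h p \<in> carrier_vec q \<and> F p - h p \<in> L \<and>
      (\<forall>j. p \<le> j \<and> j < q \<longrightarrow> h p $ j = F p $ j) \<and> (\<forall>j<p. \<forall>k\<ge>deg (F j $ j). cf (h p $ j) k = 0)"
    by metis
  let ?H = "mat q q (\<lambda>(i, j). h i $ j)"
  have row: "row ?H p = h p" if "p < q" for p using h[OF that] that by (intro eq_vecI) auto
  have hL: "h p \<in> L" if "p < q" for p
  proof -
    have Fc: "F p \<in> carrier_vec q" using F[OF that] left_submoduleD(1)[OF L] by blast
    have "F p - (F p - h p) = h p" using h[OF that] Fc by (intro eq_vecI) auto
    then show ?thesis using left_submodule_diff[OF L, of "F p" "F p - h p"] F h that by auto
  qed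
  have lead: "leads (h p) p" if "p < q" for p
    using F[OF that] h[OF that] left_submoduleD(1)[OF L, of "F p"] that
    by (auto simp: leads_def)
  have "hermite_form q L ?H"
    unfolding hermite_form_def using row hL lead h F by (auto simp: minimal_at_def)
  then show ?thesis using that by blast
qed

lemma hermite_formD:
  assumes "hermite_form q L H"
  shows "H \<in> carrier_mat q q"
    and "p < q \<Longrightarrow> row H p \<in> L" and "p < q \<Longrightarrow> leads (row H p) p"
    and "p < q \<Longrightarrow> monic (H $$ (p, p))" and "p < q \<Longrightarrow> H $$ (p, p) \<noteq> 0"
    and "\<lbrakk>p < q; f \<in> L; leads f p\<rbrakk> \<Longrightarrow> deg (H $$ (p, p)) \<le> deg (f $ p)"
    and "\<lbrakk>p < q; j < p; deg (H $$ (j, j)) \<le> k\<rbrakk> \<Longrightarrow> cf (H $$ (p, j)) k = 0"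
    and "\<lbrakk>i < j; j < q\<rbrakk> \<Longrightarrow> H $$ (i, j) = 0"
proof -
  show c: "H \<in> carrier_mat q q" using assms by (simp add: hermite_form_def)
  show lead: "p < q \<Longrightarrow> leads (row H p) p" for p using assms by (simp add: hermite_form_def)
  show "\<lbrakk>i < j; j < q\<rbrakk> \<Longrightarrow> H $$ (i, j) = 0" using lead[of i] c by (auto simp: leads_def)
qed (use assms monic_nonzero in \<open>auto simp: hermite_form_def minimal_at_def\<close>)

text \<open>The difference of two candidates for row \<open>p\<close> lies in \<open>L\<close>, and each of its entries
  has smaller degree than the diagonal entry of the column. A nonzero leading entry would contradict
  minimality.\<close>

lemma hermite_row_unique:
  assumes L: "left_submodule q L" and H: "hermite_form q L H" and p: "p < q"
    and v: "v \<in> L" "leads v p" "monic (v $ p)" "deg (v $ p) = deg (H $$ (p, p))"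
    and red: "\<And>j k. \<lbrakk>j < p; deg (H $$ (j, j)) \<le> k\<rbrakk> \<Longrightarrow> cf (v $ j) k = 0"
  shows "v = row H p"
proof -
  have vc: "v \<in> carrier_vec q" using left_submoduleD(1)[OF L v(1)] .
  have Hc: "H \<in> carrier_mat q q" using hermite_formD[OF H] by blast
  let ?u = "v - row H p"
  have uL: "?u \<in> L" using left_submodule_diff[OF L v(1)] hermite_formD(2)[OF H p] by blast
  have u: "?u $ j = v $ j - H $$ (p, j)" if "j < q" for j using that p vc Hc by simp
  have "?u = 0\<^sub>v q"
  proof (rule ccontr)
    assume "?u \<noteq> 0\<^sub>v q"
    moreover have "?u \<in> carrier_vec q" using vc Hc by auto
    ultimately obtain j where j: "leads ?u j" using leads_exists by blast
    then have jq: "j < q" using Hc by (auto simp: leads_def)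
    have "\<not> p < j" using j jq u[OF jq] v(2) hermite_formD(8)[OF H, of p j] vc
      by (auto simp: leads_def)
    moreover have min: "deg (H $$ (j, j)) \<le> deg (?u $ j)" using hermite_formD(6)[OF H jq uL j] .
    have "cf (?u $ j) k = 0" if "k \<ge> deg (H $$ (j, j))" for k
    proof (cases "j = p")
      case True
      have "cf (v $ p) k = cf (H $$ (p, p)) k"
      proof (cases "k = deg (v $ p)")
        case True
        then show ?thesis using v(3,4) hermite_formD(4)[OF H p] by (simp add: monic_def)
      next
        case False
        then show ?thesis using v(4) that \<open>j = p\<close> by (simp add: cf_above_deg)
      qed
      then show ?thesis using True u[OF jq] by (simp add: cf_diff)
    next
      case False
      then have "j < p" using \<open>\<not> p < j\<close> by simp
      then show ?thesis using that red hermite_formD(7)[OF H p] u[OF jq] by (simp add: cf_diff)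
    qed
    from this[OF min] j show False by (simp add: cf_deg_eq_0_iff leads_def)
  qed
  then have "(v - row H p) $ j = 0" if "j < q" for j using that by simp
  then show ?thesis using vc Hc p u by (intro eq_vecI) auto
qed

text \<open>If \<open>L\<close> contains a vector supported in position \<open>i\<close> alone and of least degree
  there, a unit multiple of it is the unique candidate for row \<open>i\<close>. This is how off-diagonal entries
  disappear during the algorithm.\<close>

lemma hermite_row_diagonal:
  assumes L: "left_submodule q L" and H: "hermite_form q L H" and i: "i < q"
    and v: "v \<in> L" "\<And>j. \<lbrakk>j < q; j \<noteq> i\<rbrakk> \<Longrightarrow> v $ j = 0"
    and nz: "v $ i \<noteq> 0" and deg: "deg (v $ i) \<le> deg (H $$ (i, i))" and j: "j < i"
  shows "H $$ (i, j) = 0"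
proof -
  have vc: "v \<in> carrier_vec q" using left_submoduleD(1)[OF L v(1)] .
  obtain a where a: "monic (a * v $ i)" "deg (a * v $ i) = deg (v $ i)"
    using make_monic[OF nz] by metis
  let ?v = "a \<cdot>\<^sub>v v"
  have vi: "?v $ i = a * v $ i" and vj: "\<And>j. \<lbrakk>j < q; j \<noteq> i\<rbrakk> \<Longrightarrow> ?v $ j = 0"
    using vc i v(2) by auto
  have lead: "leads ?v i" using vi vj vc i monic_nonzero[OF a(1)] by (auto simp: leads_def)
  have vL: "?v \<in> L" using left_submoduleD(4)[OF L v(1)] .
  have "deg (?v $ i) = deg (H $$ (i, i))"
    using hermite_formD(6)[OF H i vL lead] a(2) deg vi by simp
  moreover have "monic (?v $ i)" using a(1) vi by simp
  moreover have "cf (?v $ j) k = 0" if "j < i" for j k using vj[of j] that i by simp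
  ultimately have "?v = row H i" using hermite_row_unique[OF L H i vL lead] by blast
  then have "?v $ j = row H i $ j" by simp
  then show ?thesis using vj[of j] j i hermite_formD(1)[OF H] by simp
qed

end

section \<open>Reduced Groebner bases are Hermite forms\<close>

context ore_ring
begin

lemma hermite_form_is_gb_matrix:
  assumes N: "N \<in> carrier_mat m g" and H: "hermite_form g (row_module N) H"
  shows "is_gb_matrix A D N H"
proof -
  let ?L = "row_module N"
  have L: "left_submodule g ?L" using row_module_submodule[OF N] .
  note Hc = hermite_formD(1)[OF H]
  have lm_row: "lm A D (row H p) = (p, deg (H $$ (p, p)))" if "p < g" for p
    using lm_eq[OF hermite_formD(3)[OF H that]] Hc that by simp
  have set_rows: "set (rows H) = {row H p |p. p < g}" using Hc by (auto simp: rows_def)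
  have "sorted_wrt (\<lambda>f h. mon_less (lm A D f) (lm A D h)) (rows H)"
    using Hc by (auto simp: sorted_wrt_iff_nth_less lm_row mon_less_def)
  moreover have "groebner_basis A D g ?L (set (rows H))"
    unfolding groebner_basis_def
  proof (intro conjI ballI impI)
    show "set (rows H) \<subseteq> ?L" using set_rows hermite_formD(2)[OF H] by auto
    fix f assume f: "f \<in> ?L" "f \<noteq> 0\<^sub>v g"
    then obtain p where p: "leads f p" using leads_exists left_submoduleD(1)[OF L] by blast
    then have pg: "p < g" using left_submoduleD(1)[OF L f(1)] by (simp add: leads_def)
    have "row H p \<noteq> 0\<^sub>v g" using leads_nonzero[OF hermite_formD(3)[OF H pg]] .
    moreover have "mon_divides (lm A D (row H p)) (lm A D f)"
      using hermite_formD(6)[OF H pg f(1) p] by (simp add: lm_row[OF pg] lm_eq[OF p] mon_divides_def)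
    ultimately show "\<exists>h\<in>set (rows H). h \<noteq> 0\<^sub>v g \<and> mon_divides (lm A D h) (lm A D f)"
      using set_rows pg by blast
  qed simp
  moreover have "h \<noteq> 0\<^sub>v g \<and> lc A D h = 1" if h: "h \<in> set (rows H)" for h
  proof -
    obtain p where p: "p < g" "h = row H p" using h set_rows by auto
    then show ?thesis
      using leads_nonzero[OF hermite_formD(3)[OF H p(1)]] hermite_formD(4)[OF H p(1)]
        lc_eq[OF hermite_formD(3)[OF H p(1)]] Hc
      by (simp add: monic_def)
  qed
  moreover have "\<not> mon_divides (lm A D h) t"
    if f: "f \<in> set (rows H)" and h: "h \<in> set (rows H)" and hf: "h \<noteq> f" and t: "t \<in> monomials_of A D f"
    for f h t
  proof
    assume div: "mon_divides (lm A D h) t"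
    obtain p j where p: "p < g" "f = row H p" and j: "j < g" "h = row H j"
      using f h set_rows by auto
    obtain i k where ik: "t = (i, k)" by force
    then have "i = j" "deg (H $$ (j, j)) \<le> k" "cf (H $$ (p, j)) k \<noteq> 0"
      using div t p j Hc by (auto simp: mon_divides_def lm_row monomials_of_def)
    moreover have "j \<noteq> p" using hf p j by auto
    ultimately show False
      using hermite_formD(7)[OF H p(1), of j k] hermite_formD(8)[OF H, of p j] j(1)
      by (cases "j < p") auto
  qed
  ultimately show ?thesis
    unfolding is_gb_matrix_def reduced_groebner_basis_def using N Hc by simp
qed

text \<open>By reducedness, the members of a reduced Groebner basis have distinct leading positions, all of
  least degree; so each is a row of the Hermite form by \<open>hermite_row_unique\<close>. The ordering of the rows
  is then determined since they are sorted by leading position.\<close>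

lemma is_gb_matrix_unique:
  assumes N: "N \<in> carrier_mat m g" and H: "hermite_form g (row_module N) H"
    and G: "is_gb_matrix A D N G"
  shows "G = H"
proof -
  let ?L = "row_module N" and ?R = "set (rows G)"
  have L: "left_submodule g ?L" using row_module_submodule[OF N] .
  note Hc = hermite_formD(1)[OF H]
  have dim_G: "dim_col G = g"
    and sorted_G: "sorted_wrt (\<lambda>f h. mon_less (lm A D f) (lm A D h)) (rows G)"
    using G N by (auto simp: is_gb_matrix_def)
  have RL: "?R \<subseteq> ?L"
    and gb: "\<And>f. \<lbrakk>f \<in> ?L; f \<noteq> 0\<^sub>v g\<rbrakk> \<Longrightarrow> \<exists>h\<in>?R. h \<noteq> 0\<^sub>v g \<and> mon_divides (lm A D h) (lm A D f)"
    and lc1: "\<And>h. h \<in> ?R \<Longrightarrow> h \<noteq> 0\<^sub>v g \<and> lc A D h = 1"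
    and red: "\<And>f h t. \<lbrakk>f \<in> ?R; h \<in> ?R; h \<noteq> f; t \<in> monomials_of A D f\<rbrakk> \<Longrightarrow> \<not> mon_divides (lm A D h) t"
    using G N unfolding is_gb_matrix_def reduced_groebner_basis_def groebner_basis_def by auto
  have lm_mem: "lm A D f \<in> monomials_of A D f" if "leads f p" for f p
    using that by (auto simp: lm_eq[OF that] monomials_of_def leads_def cf_deg_eq_0_iff)
  have ex: "\<exists>h\<in>?R. leads h p \<and> deg (h $ p) = deg (H $$ (p, p))" if p: "p < g" for p
  proof -
    note r = hermite_formD(2,3)[OF H p]
    have "row H p \<noteq> 0\<^sub>v g" using leads_nonzero[OF r(2)] .
    then obtain h where h: "h \<in> ?R" "mon_divides (lm A D h) (lm A D (row H p))"
      using gb r(1) by blast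
    then obtain p' where p': "leads h p'"
      using leads_exists left_submoduleD(1)[OF L] RL lc1 by blast
    then have "p' = p" "deg (h $ p) \<le> deg (H $$ (p, p))"
      using h(2) Hc p by (auto simp: lm_eq[OF p'] lm_eq[OF r(2)] mon_divides_def)
    moreover from this have "deg (H $$ (p, p)) \<le> deg (h $ p)"
      using hermite_formD(6)[OF H p, of h] h(1) RL p' by blast
    ultimately show ?thesis using h(1) p' by auto
  qed
  have row_R: "\<exists>p<g. h = row H p" if h: "h \<in> ?R" for h
  proof -
    have hL: "h \<in> ?L" using h RL by blast
    then obtain p where p: "leads h p" using leads_exists left_submoduleD(1)[OF L] lc1[OF h] by blast
    then have pg: "p < g" using left_submoduleD(1)[OF L hL] by (simp add: leads_def)
    obtain h' where h': "h' \<in> ?R" "leads h' p" "deg (h' $ p) = deg (H $$ (p, p))" using ex[OF pg] by blast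
    \<comment> \<open>Reducedness forbids two members with the same leading position, so \<open>h\<close> itself is minimal.\<close>
    have "mon_divides (lm A D h') (lm A D h)"
      using hermite_formD(6)[OF H pg hL p] h'(3) by (simp add: lm_eq[OF h'(2)] lm_eq[OF p] mon_divides_def)
    then have "h' = h" using red[OF h h'(1) _ lm_mem[OF p]] by blast
    have "cf (h $ j) k = 0" if j: "j < p" "deg (H $$ (j, j)) \<le> k" for j k
    proof (rule ccontr)
      assume nz: "cf (h $ j) k \<noteq> 0"
      obtain u where u: "u \<in> ?R" "leads u j" "deg (u $ j) = deg (H $$ (j, j))"
        using ex[of j] j(1) pg by auto
      have "u \<noteq> h" using leads_unique[OF p] u(2) j(1) by blast
      moreover have "(j, k) \<in> monomials_of A D h"
        using nz j(1) p by (auto simp: monomials_of_def leads_def)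
      ultimately show False
        using red[OF h u(1)] j(2) u(3) by (auto simp: lm_eq[OF u(2)] mon_divides_def)
    qed
    moreover have "monic (h $ p)" using lc1[OF h] by (simp add: lc_eq[OF p] monic_def)
    ultimately have "h = row H p"
      using hermite_row_unique[OF L H pg hL p] h'(3) \<open>h' = h\<close> by blast
    then show ?thesis using pg by blast
  qed
  have set_rows: "set (rows H) = {row H p |p. p < g}" using Hc by (auto simp: rows_def)
  have R_eq: "?R = set (rows H)"
  proof
    show "?R \<subseteq> set (rows H)" using row_R unfolding set_rows by blast
    show "set (rows H) \<subseteq> ?R"
    proof
      fix f assume "f \<in> set (rows H)"
      then obtain p where p: "p < g" "f = row H p" using set_rows by blast
      obtain h where h: "h \<in> ?R" "leads h p" using ex[OF p(1)] by blast
      then obtain p' where "p' < g" "h = row H p'" using row_R by blast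
      then have "f = h" using leads_unique[OF h(2)] hermite_formD(3)[OF H] p by metis
      then show "f \<in> ?R" using h by simp
    qed
  qed
  let ?key = "\<lambda>f. fst (lm A D f)"
  have key: "?key (row H p) = p" if "p < g" for p
    using lm_eq[OF hermite_formD(3)[OF H that]] by simp
  have key_less: "?key f < ?key h"
    if fh: "f \<in> set (rows H)" "h \<in> set (rows H)" and less: "mon_less (lm A D f) (lm A D h)" for f h
  proof -
    obtain p p' where p: "p < g" "f = row H p" and p': "p' < g" "h = row H p'"
      using fh set_rows by auto
    then have "p \<noteq> p'" using less by (auto simp: mon_less_def)
    then show ?thesis using less key p p' by (auto simp: mon_less_def)
  qed
  have sorted_keys: "sorted_wrt (<) (map ?key xs)"
    if "set xs = set (rows H)" "sorted_wrt (\<lambda>f h. mon_less (lm A D f) (lm A D h)) xs" for xs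
    unfolding sorted_wrt_map using that key_less
    by (auto intro: sorted_wrt_mono_rel[rotated])
  have "sorted_wrt (\<lambda>f h. mon_less (lm A D f) (lm A D h)) (rows H)"
    using hermite_form_is_gb_matrix[OF N H] by (simp add: is_gb_matrix_def)
  then have "map ?key (rows G) = map ?key (rows H)"
    using sorted_keys R_eq sorted_G by (intro strict_sorted_equal) auto
  moreover have "inj_on ?key (set (rows G) \<union> set (rows H))"
    unfolding R_eq set_rows using key by (auto simp: inj_on_def)
  ultimately have rows_eq: "rows G = rows H" by (rule map_inj_on)
  then have "dim_row G = dim_row H" by (metis length_rows)
  then show ?thesis
  proof (intro eq_rowI)
    fix i assume "i < dim_row H"
    then show "row G i = row H i"
      using rows_eq \<open>dim_row G = dim_row H\<close> by (metis nth_rows)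
  qed (use dim_G Hc in auto)
qed

lemma gb_matrix_eq:
  assumes "N \<in> carrier_mat m g" and "hermite_form g (row_module N) H"
  shows "gb_matrix A D N = H"
  unfolding gb_matrix_def
  using hermite_form_is_gb_matrix[OF assms] is_gb_matrix_unique[OF assms] by (rule the_equality)

end

section \<open>Full rank\<close>

text \<open>More unknowns than equations over a skew field: eliminate one unknown by means of the
  last equation and solve the smaller system, keeping coefficients on the left throughout.\<close>

lemma homogeneous_system:
  fixes W :: "nat \<Rightarrow> nat \<Rightarrow> 'q::division_ring"
  assumes "finite I" "m < card I"
  shows "\<exists>c. (\<exists>i\<in>I. c i \<noteq> 0) \<and> (\<forall>k<m. (\<Sum>i\<in>I. c i * W i k) = 0)"
  using assms
proof (induction m arbitrary: I W)
  case 0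
  then have "I \<noteq> {}" by auto
  then show ?case by (intro exI[of _ "\<lambda>_. 1"]) auto
next
  case (Suc m)
  show ?case
  proof (cases "\<forall>i\<in>I. W i m = 0")
    case True
    obtain c where "\<exists>i\<in>I. c i \<noteq> 0" "\<forall>k<m. (\<Sum>i\<in>I. c i * W i k) = 0"
      using Suc.IH[of I W] Suc.prems by auto
    then show ?thesis using True by (intro exI[of _ c]) (auto simp: less_Suc_eq)
  next
    case False
    then obtain p where p: "p \<in> I" "W p m \<noteq> 0" by blast
    define J where "J = I - {p}"
    have J: "finite J" "m < card J" "I = insert p J" "p \<notin> J"
      using Suc.prems p by (auto simp: J_def card_Diff_singleton_if)
    define a where "a i = W i m * inverse (W p m)" for i
    obtain c where c: "\<exists>i\<in>J. c i \<noteq> 0" "\<And>k. k < m \<Longrightarrow> (\<Sum>i\<in>J. c i * (W i k - a i * W p k)) = 0"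
      using Suc.IH[OF J(1,2), of "\<lambda>i k. W i k - a i * W p k"] by auto
    \<comment> \<open>This value of the unknown \<open>p\<close> makes the last equation hold.\<close>
    define c' where "c' = c(p := - (\<Sum>i\<in>J. c i * a i))"
    have c'J: "c' i = c i" if "i \<in> J" for i using that J(4) by (auto simp: c'_def)
    have split: "(\<Sum>i\<in>I. c' i * W i k) = (\<Sum>i\<in>J. c i * (W i k - a i * W p k))" for k
    proof -
      have "(\<Sum>i\<in>I. c' i * W i k) = c' p * W p k + (\<Sum>i\<in>J. c i * W i k)"
        using J by (simp add: c'J)
      also have "\<dots> = (\<Sum>i\<in>J. c i * (W i k - a i * W p k))"
        by (simp add: c'_def right_diff_distrib sum_subtractf sum_distrib_right mult.assoc)
      finally show ?thesis .
    qed
    have "W i m - a i * W p m = 0" for i using p by (simp add: a_def mult.assoc)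
    then have "(\<Sum>i\<in>I. c' i * W i m) = 0"
      by (simp only: split mult_zero_right sum.neutral_const)
    then have "\<forall>k<Suc m. (\<Sum>i\<in>I. c' i * W i k) = 0" using c(2) split by (auto simp: less_Suc_eq)
    moreover have "\<exists>i\<in>I. c' i \<noteq> 0" using c(1) c'J J(3) by auto
    ultimately show ?thesis by blast
  qed
qed

locale ore_ring_in_skew_field = ore_ring A D \<sigma> \<delta> + inj_ring_hom \<iota>
  for A :: "'r::ring_1 set" and D \<sigma> \<delta> and \<iota> :: "'r \<Rightarrow> 'q::division_ring"
begin

text \<open>Independence is required over the skew field $Q$ containing $R$ and not only over $R$, because
  dimension arguments are available there.\<close>

definition full_rank :: "nat \<Rightarrow> 'r mat \<Rightarrow> bool" where
  "full_rank g N \<longleftrightarrow> left_independent_rows (map_mat \<iota> N) {..<g}"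

lemma skew_rank_full_rank:
  assumes M: "M \<in> carrier_mat g g" and rank: "skew_rank (map_mat \<iota> M) = g"
  shows "full_rank g M"
proof -
  let ?C = "{card S |S. S \<subseteq> {..<g} \<and> left_independent_rows (map_mat \<iota> M) S}"
  have "?C \<subseteq> {..g}" using card_mono[of "{..<g}"] by auto
  then have "finite ?C" using finite_subset by blast
  moreover have "left_independent_rows (map_mat \<iota> M) {}" by (simp add: left_independent_rows_def)
  then have "?C \<noteq> {}" by blast
  ultimately have "Max ?C \<in> ?C" by (rule Max_in)
  moreover have "Max ?C = g" using rank M by (simp add: skew_rank_def)
  ultimately obtain S where S: "S \<subseteq> {..<g}" "card S = g" "left_independent_rows (map_mat \<iota> M) S"
    by auto
  then have "S = {..<g}" by (intro card_subset_eq) auto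
  then show ?thesis using S by (simp add: full_rank_def)
qed

lemma full_rankD:
  assumes "N \<in> carrier_mat g q" "full_rank g N"
    and "\<And>j. j < q \<Longrightarrow> (\<Sum>i<g. c i * N $$ (i, j)) = 0" and "i < g"
  shows "c i = 0"
proof -
  have "\<forall>j<q. (\<Sum>i<g. \<iota> (c i) * map_mat \<iota> N $$ (i, j)) = 0"
  proof (intro allI impI)
    fix j assume "j < q"
    then have "(\<Sum>i<g. \<iota> (c i) * map_mat \<iota> N $$ (i, j)) = \<iota> (\<Sum>i<g. c i * N $$ (i, j))"
      using assms(1) by (simp add: hom_sum hom_mult)
    then show "(\<Sum>i<g. \<iota> (c i) * map_mat \<iota> N $$ (i, j)) = 0" using assms(3) \<open>j < q\<close> by simp
  qed
  then have "\<forall>i<g. \<iota> (c i) = 0"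
    using assms(1,2) unfolding full_rank_def left_independent_rows_def
    by (elim allE[of _ "\<lambda>i. \<iota> (c i)"]) auto
  then show ?thesis using assms(4) by simp
qed

text \<open>Applied with \<open>Y\<close> the identity, this turns one-sided relations between transformation
  matrices into invertibility.\<close>

lemma full_rank_cancel:
  assumes N: "N \<in> carrier_mat g q" "full_rank g N"
    and X: "X \<in> carrier_mat k g" and Y: "Y \<in> carrier_mat k g" and eq: "X * N = Y * N"
  shows "X = Y"
proof (rule eq_matI)
  fix i l assume "i < dim_row Y" "l < dim_col Y"
  then have il: "i < k" "l < g" using Y by auto
  have "(\<Sum>l<g. (X $$ (i, l) - Y $$ (i, l)) * N $$ (l, j)) = 0" if "j < q" for j
  proof -
    have "(X * N) $$ (i, j) = (Y * N) $$ (i, j)" using eq by simp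
    then show ?thesis using X Y N il that
      by (simp add: scalar_prod_def lessThan_atLeast0 left_diff_distrib sum_subtractf)
  qed
  from full_rankD[OF N, of "\<lambda>l. X $$ (i, l) - Y $$ (i, l)", OF this il(2)]
  show "X $$ (i, l) = Y $$ (i, l)" by simp
qed (use X Y in auto)

text \<open>The weight \<open>\<mu>\<close> covers both shapes: \<open>\<mu> i = i\<close> for upper and \<open>\<mu> i = g - i\<close> for lower
  triangular matrices. Column \<open>j\<close> of a vanishing combination involves, besides \<open>c j\<close>, only
  coefficients of smaller weight.\<close>

lemma triangular_full_rank:
  fixes \<mu> :: "nat \<Rightarrow> nat"
  assumes N: "N \<in> carrier_mat g g"
    and tri: "\<And>i j. \<lbrakk>i < g; j < g; i \<noteq> j; N $$ (i, j) \<noteq> 0\<rbrakk> \<Longrightarrow> \<mu> i < \<mu> j"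
    and diag: "\<And>i. i < g \<Longrightarrow> N $$ (i, i) \<noteq> 0"
  shows "full_rank g N"
  unfolding full_rank_def left_independent_rows_def
proof (intro allI impI ballI)
  fix c j assume c: "\<forall>j<dim_col (map_mat \<iota> N). (\<Sum>i<g. c i * map_mat \<iota> N $$ (i, j)) = 0"
    and "j \<in> {..<g}"
  from this(2) have "j < g" by simp
  then show "c j = 0"
  proof (induction "\<mu> j" arbitrary: j rule: less_induct)
    case less
    have "c i * map_mat \<iota> N $$ (i, j) = 0" if "i < g" "i \<noteq> j" for i
      using that less tri[of i j] N by (cases "N $$ (i, j) = 0") auto
    then have "(\<Sum>i\<in>{j}. c i * map_mat \<iota> N $$ (i, j)) = (\<Sum>i<g. c i * map_mat \<iota> N $$ (i, j))"
      using less.prems by (intro sum.mono_neutral_left) auto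
    then have "c j * \<iota> (N $$ (j, j)) = 0" using c N less.prems by simp
    then show ?case using diag[OF less.prems] by simp
  qed
qed

text \<open>If some position were not a leading position, fewer than \<open>g\<close> vectors would generate the row
  module. Then $N=WE$ with $W$ having fewer columns than rows, and a nontrivial left kernel vector
  of $W$ over $Q$ would be one of $N$.\<close>

lemma full_rank_leads:
  assumes N: "N \<in> carrier_mat g g" "full_rank g N" and p: "p < g"
  shows "\<exists>f\<in>row_module N. leads f p"
proof (rule ccontr)
  let ?L = "row_module N"
  have L: "left_submodule g ?L" using row_module_submodule N(1) .
  define P where "P = {p. \<exists>f\<in>?L. leads f p}"
  assume "\<not> ?thesis"
  then have "p \<notin> P" by (simp add: P_def)
  have Pg: "P \<subseteq> {..<g}" by (auto simp: P_def leads_def dest!: left_submoduleD(1)[OF L])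
  then have "P \<subset> {..<g}" using p \<open>p \<notin> P\<close> by auto
  then have card: "card P < g" using psubset_card_mono[of "{..<g}" P] by simp
  have finP: "finite P" using Pg finite_subset by blast
  have "\<exists>h. h \<in> ?L \<and> leads h p \<and> monic (h $ p) \<and> minimal_at ?L p (h $ p)" if "p \<in> P" for p
    using that minimal_leader[OF L] unfolding P_def by blast
  then obtain F where F: "\<And>p. p \<in> P \<Longrightarrow> F p \<in> ?L \<and> leads (F p) p \<and> monic (F p $ p) \<and> minimal_at ?L p (F p $ p)"
    by metis
  obtain e where e: "bij_betw e {0..<card P} P" using ex_bij_betw_nat_finite[OF finP] by blast
  let ?m = "card P"
  \<comment> \<open>The rows of \<open>E\<close> are minimal vectors, one for each leading position that occurs.\<close>
  let ?E = "mat ?m g (\<lambda>(i, j). F (e i) $ j)"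
  have E: "?E \<in> carrier_mat ?m g" by simp
  have eP: "e i \<in> P" if "i < ?m" for i using e that by (auto simp: bij_betw_def)
  have rowE: "row ?E i = F (e i)" if "i < ?m" for i
    using F[OF eP[OF that]] left_submoduleD(1)[OF L, of "F (e i)"] that by (intro eq_vecI) auto
  have FE: "F p \<in> row_module ?E" if p: "p \<in> P" for p
  proof -
    have "p \<in> e ` {0..<?m}" using e p by (simp add: bij_betw_def)
    then obtain i where i: "i < ?m" "p = e i" by auto
    then show ?thesis using row_in_row_module[OF E i(1)] rowE by simp
  qed
  have sub: "row_module ?E \<subseteq> ?L" using row_module_least[OF E L] rowE F eP by simp
  have "row N i \<in> row_module ?E" if "i < g" for i
  proof (rule minimal_leaders_generate[OF L row_module_submodule[OF E] sub, of P F])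
    show "row N i \<in> ?L" using row_in_row_module[OF N(1) that] .
  qed (use F FE Pg in \<open>auto simp: P_def\<close>)
  then obtain W where W: "W \<in> carrier_mat g ?m" "W * ?E = N"
    using rows_in_row_module[OF E N(1)] by blast
  obtain c where c: "\<exists>i\<in>{..<g}. c i \<noteq> 0" "\<And>k. k < ?m \<Longrightarrow> (\<Sum>i<g. c i * \<iota> (W $$ (i, k))) = 0"
    using homogeneous_system[of "{..<g}" ?m "\<lambda>i k. \<iota> (W $$ (i, k))"] card by auto
  have "(\<Sum>i<g. c i * map_mat \<iota> N $$ (i, j)) = 0" if j: "j < g" for j
  proof -
    have "map_mat \<iota> N $$ (i, j) = (\<Sum>k<?m. \<iota> (W $$ (i, k)) * \<iota> (?E $$ (k, j)))" if i: "i < g" for i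
    proof -
      have "N $$ (i, j) = (\<Sum>k<?m. W $$ (i, k) * ?E $$ (k, j))"
        using W(1) i j by (subst W(2)[symmetric]) (simp add: scalar_prod_def lessThan_atLeast0)
      then show ?thesis using N(1) i j by (simp add: hom_sum hom_mult)
    qed
    then have "(\<Sum>i<g. c i * map_mat \<iota> N $$ (i, j))
        = (\<Sum>i<g. \<Sum>k<?m. c i * \<iota> (W $$ (i, k)) * \<iota> (?E $$ (k, j)))"
      by (simp add: sum_distrib_left mult.assoc)
    also have "\<dots> = (\<Sum>k<?m. (\<Sum>i<g. c i * \<iota> (W $$ (i, k))) * \<iota> (?E $$ (k, j)))"
      by (subst sum.swap) (simp add: sum_distrib_right)
    also have "\<dots> = 0" using c(2) by simp
    finally show ?thesis .
  qed
  then have "\<forall>i\<in>{..<g}. c i = 0"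
    using N unfolding full_rank_def left_independent_rows_def by auto
  then show False using c(1) by blast
qed

text \<open>Both $G$ and $N$ have full rank and generate the same module, so each is a left multiple of the
  other and cancellation makes the two multipliers inverse to each other.\<close>

lemma full_rank_gb:
  assumes N: "N \<in> carrier_mat g g" "full_rank g N"
  defines "G \<equiv> gb_matrix A D N" and "W \<equiv> gb_transform A D N"
  shows "hermite_form g (row_module N) G" and "is_gb_matrix A D N G"
    and "is_gb_transform A D N W" and "W \<in> carrier_mat g g" and "W * N = G" and "invertible_mat W"
proof -
  let ?L = "row_module N"
  have L: "left_submodule g ?L" using row_module_submodule N(1) .
  obtain H where "hermite_form g ?L H" using hermite_form_exists[OF L full_rank_leads[OF N]] by blast
  then show G: "hermite_form g ?L G" unfolding G_def using gb_matrix_eq[OF N(1)] by simp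
  show "is_gb_matrix A D N G" using hermite_form_is_gb_matrix[OF N(1) G] .
  note Gc = hermite_formD(1)[OF G]
  obtain X where X: "X \<in> carrier_mat g g" "X * N = G"
    using rows_in_row_module[OF N(1) Gc hermite_formD(2)[OF G]] by blast
  then have "is_gb_transform A D N X" using Gc N(1) by (simp add: is_gb_transform_def G_def)
  then show W: "is_gb_transform A D N W" unfolding W_def gb_transform_def by (rule someI)
  then show Wc: "W \<in> carrier_mat g g" and WN: "W * N = G"
    using Gc N(1) by (auto simp: is_gb_transform_def G_def)
  have GL: "left_submodule g (row_module G)" using row_module_submodule[OF Gc] .
  have sub: "row_module G \<subseteq> ?L" using row_module_least[OF Gc L hermite_formD(2)[OF G]] .
  have "row N i \<in> row_module G" if "i < g" for i
  proof (rule minimal_leaders_generate[OF L GL sub, of "{..<g}" "row G"])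
    show "row N i \<in> ?L" using row_in_row_module[OF N(1) that] .
    fix p assume "p \<in> {..<g}"
    then have p: "p < g" by simp
    then show "row G p \<in> row_module G \<and> leads (row G p) p \<and> monic (row G p $ p) \<and> minimal_at ?L p (row G p $ p)"
      using row_in_row_module[OF Gc p] hermite_formD(3,4,6)[OF G p] Gc by (auto simp: minimal_at_def)
  next
    fix f p assume "f \<in> ?L" "leads f p"
    then show "p \<in> {..<g}" by (auto simp: leads_def dest!: left_submoduleD(1)[OF L])
  qed simp
  then obtain X where X: "X \<in> carrier_mat g g" "X * G = N" using rows_in_row_module[OF Gc N(1)] by blast
  have G_full: "full_rank g G"
  proof (rule triangular_full_rank[OF Gc, of "\<lambda>i. g - i"])
    fix i j assume "i < g" "j < g" "i \<noteq> j" "G $$ (i, j) \<noteq> 0"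
    then show "g - i < g - j" using hermite_formD(8)[OF G, of i j] by (cases "i < j") auto
  qed (use hermite_formD(5)[OF G] in auto)
  have "X * W * N = 1\<^sub>m g * N"
    using assoc_mult_mat[OF X(1) Wc N(1)] X(2) WN N(1) by simp
  then have XW: "X * W = 1\<^sub>m g" using full_rank_cancel[OF N] X(1) Wc by (metis mult_carrier_mat one_carrier_mat)
  have "W * X * G = 1\<^sub>m g * G"
    using assoc_mult_mat[OF Wc X(1) Gc] X(2) WN Gc by simp
  then have WX: "W * X = 1\<^sub>m g" using full_rank_cancel[OF Gc G_full] X(1) Wc by (metis mult_carrier_mat one_carrier_mat)
  show "invertible_mat W"
    unfolding invertible_mat_def inverts_mat_def using XW WX X(1) Wc by auto
qed

end

section \<open>Involutions preserve the degree\<close>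

locale ore_ring_involution = ore_ring A D \<sigma> \<delta>
  for A :: "'r::ring_1 set" and D \<sigma> \<delta> +
  fixes \<theta> :: "'r \<Rightarrow> 'r"
  assumes \<theta>_add: "\<theta> (a + b) = \<theta> a + \<theta> b"
    and \<theta>_mult: "\<theta> (a * b) = \<theta> b * \<theta> a"
    and \<theta>_\<theta>: "\<theta> (\<theta> a) = a"
begin

lemma \<theta>_0 [simp]: "\<theta> 0 = 0"
  using \<theta>_add[of 0 0] by simp

lemma \<theta>_1 [simp]: "\<theta> 1 = 1"
  using \<theta>_mult[of "\<theta> 1" 1] by (simp add: \<theta>_\<theta>)

lemma \<theta>_eq_0_iff [simp]: "\<theta> a = 0 \<longleftrightarrow> a = 0"
  by (metis \<theta>_0 \<theta>_\<theta>)

lemma \<theta>_sum: "\<theta> (sum f I) = (\<Sum>i\<in>I. \<theta> (f i))"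
  by (induction I rule: infinite_finite_induct) (auto simp: \<theta>_add)

lemma \<theta>_in_A: "a \<in> A \<Longrightarrow> \<theta> a \<in> A"
proof (cases "a = 0")
  case False
  assume "a \<in> A"
  then obtain b where "b * a = 1" using A_inverse False by blast
  then have "\<theta> a * \<theta> b = 1" using \<theta>_mult[of b a] by simp
  then show ?thesis by (rule unit_in_A)
qed simp

lemma deg_D: "deg D = 1"
  by (rule deg_eqI) (auto simp: cf_D)

text \<open>Write $f=q\partial+r$ with $r\in A$. Then $\theta(f)=\theta(\partial)\theta(q)+\theta(r)$ with
  $\theta(r)\in A$, and the first summand dominates because $\theta(\partial)\notin A$.\<close>

lemma deg_\<theta>_scaled:
  assumes "f \<noteq> 0" shows "deg (\<theta> f) = deg (\<theta> D) * deg f"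
  using assms
proof (induction "deg f" arbitrary: f)
  case 0
  then have "f \<in> A" by (simp add: deg_eq_0_iff)
  then have "deg (\<theta> f) = 0" using \<theta>_in_A by (simp add: deg_eq_0_iff)
  then show ?case using 0 by simp
next
  case (Suc n)
  have D: "monic D" by (simp add: monic_def deg_D cf_D)
  then have "D \<noteq> 0" by (rule monic_nonzero)
  \<comment> \<open>Otherwise $\partial=\theta(\theta(\partial))$ would lie in $A$.\<close>
  have \<theta>D: "deg (\<theta> D) > 0"
    using \<theta>_in_A[of "\<theta> D"] deg_D by (auto simp: \<theta>_\<theta> deg_eq_0_iff[symmetric] intro: gr0I)
  obtain q where q: "\<And>k. k \<ge> deg D \<Longrightarrow> cf (f - q * D) k = 0" using right_division[OF D] by blast
  define r where "r = f - q * D"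
  have r: "deg r = 0"
    using q deg_lessI[of r 1] deg_D by (cases "r = 0") (auto simp: r_def deg_eq_0_iff A_zero)
  have f: "f = q * D + r" by (simp add: r_def)
  have "q \<noteq> 0" using f r Suc.hyps(2) by auto
  have qD: "q * D \<noteq> 0" "deg (q * D) = Suc (deg q)" using deg_mult[OF \<open>q \<noteq> 0\<close> \<open>D \<noteq> 0\<close>] deg_D by auto
  then have "deg f = Suc (deg q)" using f r deg_add_dominant[of "q * D" r] by simp
  then have n: "n = deg q" using Suc.hyps(2) by simp
  have IH: "deg (\<theta> q) = deg (\<theta> D) * deg q" using Suc.hyps(1)[OF n \<open>q \<noteq> 0\<close>] .
  have prod: "\<theta> D * \<theta> q \<noteq> 0" "deg (\<theta> D * \<theta> q) = deg (\<theta> D) + deg (\<theta> q)"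
    using deg_mult[of "\<theta> D" "\<theta> q"] \<open>D \<noteq> 0\<close> \<open>q \<noteq> 0\<close> by auto
  have "deg (\<theta> r) = 0" using r \<theta>_in_A by (simp add: deg_eq_0_iff)
  then have "deg (\<theta> D * \<theta> q + \<theta> r) = deg (\<theta> D * \<theta> q)"
    using prod \<theta>D by (intro deg_add_dominant) auto
  then have "deg (\<theta> f) = deg (\<theta> D) + deg (\<theta> D) * deg q"
    using prod IH by (simp add: f \<theta>_add \<theta>_mult)
  then show ?case using \<open>deg f = Suc (deg q)\<close> by simp
qed

text \<open>The scaling factor $e=\deg\theta(\partial)$ satisfies $e\cdot e=\deg\partial=1$.\<close>

lemma deg_\<theta>: "deg (\<theta> f) = deg f"
proof (cases "f = 0")
  case False
  have "D \<noteq> 0" using deg_D deg_eq_0_iff[of 0] A_zero by auto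
  then have "deg (\<theta> (\<theta> D)) = deg (\<theta> D) * deg (\<theta> D)" using deg_\<theta>_scaled[of "\<theta> D"] by simp
  then have "deg (\<theta> D) = 1" by (simp add: \<theta>_\<theta> deg_D)
  then show ?thesis using deg_\<theta>_scaled[OF False] by simp
qed simp

lemma theta_mat_index:
  assumes "N \<in> carrier_mat m q" "i < q" "j < m"
  shows "theta_mat \<theta> N $$ (i, j) = \<theta> (N $$ (j, i))"
  using assms by (simp add: theta_mat_def)

lemma theta_mat_carrier: "N \<in> carrier_mat m q \<Longrightarrow> theta_mat \<theta> N \<in> carrier_mat q m"
  by (simp add: theta_mat_def)

lemma theta_mat_mult:
  assumes "X \<in> carrier_mat m k" "Y \<in> carrier_mat k q"
  shows "theta_mat \<theta> (X * Y) = theta_mat \<theta> Y * theta_mat \<theta> X"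
  using assms by (intro eq_matI) (auto simp: theta_mat_def scalar_prod_def \<theta>_sum \<theta>_mult)

lemma theta_mat_theta_mat: "theta_mat \<theta> (theta_mat \<theta> N) = N"
  by (intro eq_matI) (auto simp: theta_mat_def \<theta>_\<theta>)

lemma theta_mat_one: "theta_mat \<theta> (1\<^sub>m g) = 1\<^sub>m g"
  by (intro eq_matI) (auto simp: theta_mat_def)

lemma theta_mat_invertible:
  assumes W: "W \<in> carrier_mat g g" "invertible_mat W"
  shows "invertible_mat (theta_mat \<theta> W)"
proof -
  obtain X where X: "W * X = 1\<^sub>m g" "X * W = 1\<^sub>m (dim_row X)"
    using W by (auto simp: invertible_mat_def inverts_mat_def)
  have Xc: "X \<in> carrier_mat g g"
    using arg_cong[OF X(1), of dim_col] arg_cong[OF X(2), of dim_col] W(1) by auto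
  have "theta_mat \<theta> X * theta_mat \<theta> W = 1\<^sub>m g" "theta_mat \<theta> W * theta_mat \<theta> X = 1\<^sub>m g"
    using theta_mat_mult[OF W(1) Xc] theta_mat_mult[OF Xc W(1)] X Xc theta_mat_one[of g] by simp_all
  then show ?thesis
    using theta_mat_carrier[OF W(1)] theta_mat_carrier[OF Xc]
    unfolding invertible_mat_def inverts_mat_def by auto
qed

end

section \<open>Descent on pivots\<close>

text \<open>Only entries left of the diagonal are mentioned, since this is applied to lower triangular
  matrices.\<close>

definition diagonal_from :: "nat \<Rightarrow> 'r::zero mat \<Rightarrow> bool" where
  "diagonal_from t H \<longleftrightarrow> (\<forall>i<dim_row H. t \<le> i \<longrightarrow> (\<forall>j<i. H $$ (i, j) = 0))"

context ore_ring_involution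
begin

text \<open>In row \<open>i\<close> of $\widetilde\theta(H)$ the entries left of the diagonal vanish by triangularity of
  \<open>H\<close>, those right of it because they come from later rows of \<open>H\<close>. Hence one more row is
  diagonal than in \<open>H\<close>, whence \<open>t \<le> Suc i\<close>.\<close>

lemma theta_row:
  assumes H: "H \<in> carrier_mat g g" "diagonal_from t H" and tri: "\<And>i j. \<lbrakk>i < j; j < g\<rbrakk> \<Longrightarrow> H $$ (i, j) = 0"
    and i: "t \<le> Suc i" "i < g" and j: "j < g" "j \<noteq> i"
  shows "row (theta_mat \<theta> H) i $ j = 0"
proof -
  have "H $$ (j, i) = 0"
  proof (cases "j < i")
    case True then show ?thesis using tri i by simp
  next
    case False
    then show ?thesis using H i j by (auto simp: diagonal_from_def)
  qed
  then show ?thesis using H(1) i j theta_mat_carrier[OF H(1)] by (simp add: theta_mat_index[OF H(1)])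
qed

text \<open>For $i\ge t$ both row and column $i$ of $\widetilde\theta(H)$ vanish off the diagonal. So the $i$-th
  entries of module elements are left multiples of $\theta(H_{ii})$, and $\theta(H_{ii})e_i$ has least
  degree in its position.\<close>

lemma diagonal_from_step:
  assumes H: "hermite_form g L H" "diagonal_from t H"
    and H': "hermite_form g (row_module (theta_mat \<theta> H)) H'"
  shows "diagonal_from t H'"
proof -
  note Hc = hermite_formD(1)[OF H(1)]
  note Nc = theta_mat_carrier[OF Hc]
  let ?N = "theta_mat \<theta> H"
  have L: "left_submodule g (row_module ?N)" using row_module_submodule[OF Nc] .
  have "H' $$ (i, j) = 0" if i: "i < g" "t \<le> i" and j: "j < i" for i j
  proof -
    let ?v = "row ?N i"
    have v: "?v \<in> row_module ?N" "\<And>j. \<lbrakk>j < g; j \<noteq> i\<rbrakk> \<Longrightarrow> ?v $ j = 0"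
      using row_in_row_module[OF Nc] theta_row[OF Hc H(2) hermite_formD(8)[OF H(1)]] i by auto
    have vi: "?v $ i = \<theta> (H $$ (i, i))" using i Nc by (simp add: theta_mat_index[OF Hc])
    have nz: "?v $ i \<noteq> 0" using vi hermite_formD(5)[OF H(1) i(1)] by simp
    obtain r where r: "\<And>j. j < g \<Longrightarrow> row H' i $ j = (\<Sum>k<g. r k * ?N $$ (k, j))"
      using hermite_formD(2)[OF H' i(1)] unfolding row_module_iff[OF Nc] by blast
    have "r k * ?N $$ (k, i) = 0" if "k < g" "k \<noteq> i" for k
    proof -
      have "H $$ (i, k) = 0"
        using that i H(2) hermite_formD(8)[OF H(1), of i k] Hc
        by (cases "k < i") (auto simp: diagonal_from_def)
      then show ?thesis using that i by (simp add: theta_mat_index[OF Hc])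
    qed
    then have "(\<Sum>k<g. r k * ?N $$ (k, i)) = (\<Sum>k\<in>{i}. r k * ?N $$ (k, i))"
      using i by (intro sum.mono_neutral_right) auto
    then have "H' $$ (i, i) = r i * ?v $ i"
      using r[OF i(1)] i hermite_formD(1)[OF H'] Nc by simp
    then have "deg (?v $ i) \<le> deg (H' $$ (i, i))"
      using deg_mult(2)[of "r i" "?v $ i"] nz hermite_formD(5)[OF H' i(1)] by (cases "r i = 0") auto
    then show ?thesis using hermite_row_diagonal[OF L H' i(1) v nz _ j] by simp
  qed
  then show ?thesis using hermite_formD(1)[OF H'] by (simp add: diagonal_from_def)
qed

text \<open>The entries of $\widetilde\theta(H)$ above the pivot are arbitrary; the new pivot is a greatest
  common right divisor of that column, of degree at most $\deg\theta(H_{tt})$. No drop in degree means that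
  $\theta(H_{tt})e_t$ has least degree.\<close>

lemma pivot_step:
  assumes H: "hermite_form g L H" "diagonal_from (Suc t) H" and t: "t < g"
    and H': "hermite_form g (row_module (theta_mat \<theta> H)) H'"
  shows "deg (H' $$ (t, t)) \<le> deg (H $$ (t, t))"
    and "deg (H' $$ (t, t)) = deg (H $$ (t, t)) \<Longrightarrow> diagonal_from t H'"
proof -
  note Hc = hermite_formD(1)[OF H(1)]
  note Nc = theta_mat_carrier[OF Hc]
  let ?N = "theta_mat \<theta> H"
  let ?v = "row ?N t"
  have L: "left_submodule g (row_module ?N)" using row_module_submodule[OF Nc] .
  have v: "?v \<in> row_module ?N" "\<And>j. \<lbrakk>j < g; j \<noteq> t\<rbrakk> \<Longrightarrow> ?v $ j = 0"
    using row_in_row_module[OF Nc] theta_row[OF Hc H(2) hermite_formD(8)[OF H(1)]] t by auto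
  have vt: "?v $ t = \<theta> (H $$ (t, t))" using t Nc by (simp add: theta_mat_index[OF Hc])
  have nz: "?v $ t \<noteq> 0" using vt hermite_formD(5)[OF H(1) t] by simp
  have "leads ?v t" using v(2) nz t Nc by (auto simp: leads_def)
  from hermite_formD(6)[OF H' t v(1) this] show "deg (H' $$ (t, t)) \<le> deg (H $$ (t, t))"
    by (simp add: vt deg_\<theta>)
  assume eq: "deg (H' $$ (t, t)) = deg (H $$ (t, t))"
  have "H' $$ (t, j) = 0" if "j < t" for j
    using hermite_row_diagonal[OF L H' t v nz _ that] eq vt deg_\<theta> by simp
  moreover have "diagonal_from (Suc t) H'" using diagonal_from_step[OF H H'] .
  ultimately show "diagonal_from t H'" unfolding diagonal_from_def
    by (metis le_neq_implies_less Suc_leI)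
qed

text \<open>Clear the rows from the last to the first: while row \<open>t\<close> is not diagonal, the degree of
  its pivot drops with each step.\<close>

lemma iteration_diagonalizes:
  assumes H: "\<And>i. hermite_form g (L i) (H i)"
    and step: "\<And>i. L (Suc i) = row_module (theta_mat \<theta> (H i))"
  shows "\<exists>i. diagonal_from 0 (H i)"
proof -
  have H': "hermite_form g (row_module (theta_mat \<theta> (H i))) (H (Suc i))" for i
    using H[of "Suc i"] step by simp
  \<comment> \<open>\<open>s\<close> counts the cleared rows, the last ones of the matrix.\<close>
  have "\<exists>i. diagonal_from (g - s) (H i)" for s
  proof (induction s)
    case 0
    have "diagonal_from g (H 0)" using hermite_formD(1)[OF H[of 0]] by (simp add: diagonal_from_def)
    then show ?case by auto
  next
    case (Suc s)
    show ?case
    proof (cases "s < g")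
      case False
      then show ?thesis using Suc by simp
    next
      case True
      define t where "t = g - Suc s"
      have t: "t < g" "g - s = Suc t" using True by (auto simp: t_def)
      obtain i where i: "diagonal_from (Suc t) (H i)" using Suc t by auto
      have d: "diagonal_from (Suc t) (H (i + n))" for n
        by (induction n) (use i diagonal_from_step[OF H _ H'] in auto)
      show ?thesis unfolding t_def[symmetric]
      proof (rule ccontr)
        assume no: "\<nexists>i. diagonal_from t (H i)"
        have "deg (H (i + n) $$ (t, t)) + n \<le> deg (H i $$ (t, t))" for n
        proof (induction n)
          case (Suc n)
          have "deg (H (Suc (i + n)) $$ (t, t)) < deg (H (i + n) $$ (t, t))"
            using pivot_step[OF H d t(1) H', of n] no by (metis le_neq_implies_less)
          then show ?case using Suc by simp
        qed simp
        from this[of "Suc (deg (H i $$ (t, t)))"] show False by simp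
      qed
    qed
  qed
  from this[of g] show ?thesis by simp
qed

end

section \<open>Execution and correctness of the loop\<close>

lemma invertible_mat_mult:
  fixes X Y :: "'r::ring_1 mat"
  assumes X: "X \<in> carrier_mat g g" "invertible_mat X" and Y: "Y \<in> carrier_mat g g" "invertible_mat Y"
  shows "invertible_mat (X * Y)"
proof -
  have inv: "\<exists>Z'\<in>carrier_mat g g. Z * Z' = 1\<^sub>m g \<and> Z' * Z = 1\<^sub>m g"
    if Z: "Z \<in> carrier_mat g g" "invertible_mat Z" for Z :: "'r mat"
  proof -
    obtain Z' where Z': "Z * Z' = 1\<^sub>m g" "Z' * Z = 1\<^sub>m (dim_row Z')"
      using Z by (auto simp: invertible_mat_def inverts_mat_def)
    have "Z' \<in> carrier_mat g g"
      using arg_cong[OF Z'(1), of dim_col] arg_cong[OF Z'(2), of dim_col] Z(1) by auto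
    then show ?thesis using Z' by auto
  qed
  obtain X' Y' where X': "X' \<in> carrier_mat g g" "X * X' = 1\<^sub>m g" "X' * X = 1\<^sub>m g"
    and Y': "Y' \<in> carrier_mat g g" "Y * Y' = 1\<^sub>m g" "Y' * Y = 1\<^sub>m g"
    using inv[OF X] inv[OF Y] by blast
  note c = X(1) Y(1) X'(1) Y'(1)
  have "X * Y * (Y' * X') = X * (Y * Y') * X'" "Y' * X' * (X * Y) = Y' * (X' * X) * Y"
    using c by (simp_all add: assoc_mult_mat[of _ g g _ g _ g])
  then have "X * Y * (Y' * X') = 1\<^sub>m g" "Y' * X' * (X * Y) = 1\<^sub>m g"
    using c X' Y' by simp_all
  then show ?thesis using c unfolding invertible_mat_def inverts_mat_def
    by (intro conjI exI[of _ "Y' * X'"]) auto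
qed

lemma diag_body_state: "\<exists>U V. (diag_body A D \<theta> ^^ i) (diag_init g M) = (i, U, V, diag_M A D \<theta> g M i)"
proof -
  have "fst ((diag_body A D \<theta> ^^ i) (diag_init g M)) = i"
  proof (induction i)
    case (Suc i)
    obtain j U V N where "(diag_body A D \<theta> ^^ i) (diag_init g M) = (j, U, V, N)"
      by (cases "(diag_body A D \<theta> ^^ i) (diag_init g M)") auto
    then show ?case using Suc by (simp add: Let_def)
  qed (simp add: diag_init_def)
  then show ?thesis unfolding diag_M_def
    by (cases "(diag_body A D \<theta> ^^ i) (diag_init g M)") auto
qed

lemma diag_M_0: "diag_M A D \<theta> g M 0 = M"
  by (simp add: diag_M_def diag_init_def)

lemma diag_M_Suc: "diag_M A D \<theta> g M (Suc i) = theta_mat \<theta> (gb_matrix A D (diag_M A D \<theta> g M i))"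
proof -
  obtain U V where "(diag_body A D \<theta> ^^ i) (diag_init g M) = (i, U, V, diag_M A D \<theta> g M i)"
    using diag_body_state by metis
  then show ?thesis by (subst diag_M_def) (simp add: Let_def)
qed

text \<open>The guard also demands an even counter, which is why the loop stops at the first even index not
  below \<open>k\<close>.\<close>

lemma DIAG_result:
  assumes diag: "diagonal_mat (diag_M A D \<theta> g M k)"
    and first: "\<And>j. j < k \<Longrightarrow> \<not> diagonal_mat (diag_M A D \<theta> g M j)"
    and l: "l = k + k mod 2" and diag_l: "diagonal_mat (diag_M A D \<theta> g M l)"
  shows "DIAG A D \<theta> g M = Some ((diag_body A D \<theta> ^^ l) (diag_init g M))"
proof -
  have guard: "diag_guard ((diag_body A D \<theta> ^^ i) (diag_init g M)) \<longleftrightarrow>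
      \<not> diagonal_mat (diag_M A D \<theta> g M i) \<or> odd i" for i
  proof -
    obtain U V where "(diag_body A D \<theta> ^^ i) (diag_init g M) = (i, U, V, diag_M A D \<theta> g M i)"
      using diag_body_state by metis
    then show ?thesis by simp
  qed
  have "even l" unfolding l by presburger
  then have stop: "\<not> diag_guard ((diag_body A D \<theta> ^^ l) (diag_init g M))" using guard diag_l by simp
  have "l \<le> i" if "\<not> diag_guard ((diag_body A D \<theta> ^^ i) (diag_init g M))" for i
  proof -
    have "diagonal_mat (diag_M A D \<theta> g M i)" "even i" using that guard by auto
    then have "k \<le> i" using first by (meson not_less)
    then show ?thesis using \<open>even i\<close> unfolding l by presburger
  qed
  then have "(LEAST i. \<not> diag_guard ((diag_body A D \<theta> ^^ i) (diag_init g M))) = l"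
    using stop by (intro Least_equality) auto
  then show ?thesis unfolding DIAG_def while_option_def using stop by auto
qed

locale diag_setting = ore_ring_in_skew_field A D \<sigma> \<delta> \<iota> + ore_ring_involution A D \<sigma> \<delta> \<theta>
  for A :: "'r::ring_1 set" and D \<sigma> \<delta> and \<iota> :: "'r \<Rightarrow> 'q::division_ring" and \<theta>
begin

lemma diag_M_full_rank:
  assumes "M \<in> carrier_mat g g" "full_rank g M"
  shows "diag_M A D \<theta> g M i \<in> carrier_mat g g \<and> full_rank g (diag_M A D \<theta> g M i)"
proof (induction i)
  case 0 then show ?case using assms by (simp add: diag_M_0)
next
  case (Suc i)
  let ?H = "gb_matrix A D (diag_M A D \<theta> g M i)"
  have H: "hermite_form g (row_module (diag_M A D \<theta> g M i)) ?H" using full_rank_gb(1) Suc by blast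
  note Hc = hermite_formD(1)[OF H]
  have "full_rank g (theta_mat \<theta> ?H)"
  proof (rule triangular_full_rank[OF theta_mat_carrier[OF Hc], of "\<lambda>i. i"])
    fix i j assume "i < g" "j < g" "i \<noteq> j" "theta_mat \<theta> ?H $$ (i, j) \<noteq> 0"
    then show "i < j" using hermite_formD(8)[OF H, of j i] by (cases "j < i") (auto simp: theta_mat_index[OF Hc])
  qed (use hermite_formD(5)[OF H] in \<open>auto simp: theta_mat_index[OF Hc]\<close>)
  then show ?case using theta_mat_carrier[OF Hc] by (simp add: diag_M_Suc)
qed

text \<open>Each step multiplies the current matrix by \<open>W\<close> from the left and applies $\widetilde\theta$, which
  reverses products. So \<open>W\<close> is collected in \<open>U\<close> while the matrix is untransposed, and
  $\widetilde\theta(W)$ in \<open>V\<close> otherwise.\<close>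

lemma diag_transforms:
  assumes M: "M \<in> carrier_mat g g" "full_rank g M"
  shows "\<exists>U V. (diag_body A D \<theta> ^^ i) (diag_init g M) = (i, U, V, diag_M A D \<theta> g M i) \<and>
     U \<in> carrier_mat g g \<and> invertible_mat U \<and> V \<in> carrier_mat g g \<and> invertible_mat V \<and>
     U * M * V = (if even i then diag_M A D \<theta> g M i else theta_mat \<theta> (diag_M A D \<theta> g M i))"
proof (induction i)
  case 0
  have "invertible_mat (1\<^sub>m g :: 'r mat)"
    unfolding invertible_mat_def inverts_mat_def by (auto intro!: exI[of _ "1\<^sub>m g"])
  then show ?case using M(1) by (auto simp: diag_init_def diag_M_0)
next
  case (Suc i)
  let ?N = "diag_M A D \<theta> g M i"
  let ?W = "gb_transform A D ?N" and ?H = "gb_matrix A D ?N"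
  have N: "?N \<in> carrier_mat g g" "full_rank g ?N" using diag_M_full_rank[OF M] by auto
  note W = full_rank_gb(4-6)[OF N]
  obtain U V where st: "(diag_body A D \<theta> ^^ i) (diag_init g M) = (i, U, V, ?N)"
    and U: "U \<in> carrier_mat g g" "invertible_mat U" and V: "V \<in> carrier_mat g g" "invertible_mat V"
    and UMV: "U * M * V = (if even i then ?N else theta_mat \<theta> ?N)" using Suc by blast
  show ?case
  proof (cases "even i")
    case True
    have "?W * U * M * V = ?W * (U * M * V)"
      using W(1) U(1) V(1) M(1) by (simp add: assoc_mult_mat[of _ g g _ g _ g])
    then have "?W * U * M * V = ?H" using UMV True W(2) by simp
    then show ?thesis
      using st True W U V invertible_mat_mult[OF W(1,3) U]
      by (intro exI[of _ "?W * U"] exI[of _ V]) (auto simp: Let_def diag_M_Suc theta_mat_theta_mat)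
  next
    case False
    note T = theta_mat_carrier[OF W(1)] theta_mat_invertible[OF W(1,3)]
    have "U * M * (V * theta_mat \<theta> ?W) = U * M * V * theta_mat \<theta> ?W"
      using T(1) U(1) V(1) M(1) by (simp add: assoc_mult_mat[of _ g g _ g _ g])
    then have "U * M * (V * theta_mat \<theta> ?W) = theta_mat \<theta> ?H"
      using UMV False W(2) theta_mat_mult[OF W(1) N(1)] by simp
    then show ?thesis
      using st False U V T invertible_mat_mult[OF V T]
      by (intro exI[of _ U] exI[of _ "V * theta_mat \<theta> ?W"]) (auto simp: Let_def diag_M_Suc)
  qed
qed

text \<open>\<open>H\<close> is triangular, so half of the off-diagonal entries vanish anyway.\<close>

lemma diagonal_theta_mat_iff:
  assumes "hermite_form g L H"
  shows "diagonal_mat (theta_mat \<theta> H) \<longleftrightarrow> diagonal_from 0 H"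
proof -
  note Hc = hermite_formD(1)[OF assms]
  have "diagonal_mat (theta_mat \<theta> H) \<longleftrightarrow> (\<forall>i<g. \<forall>j<g. i \<noteq> j \<longrightarrow> H $$ (j, i) = 0)"
    using theta_mat_carrier[OF Hc] by (auto simp: diagonal_mat_def theta_mat_index[OF Hc])
  also have "\<dots> \<longleftrightarrow> diagonal_from 0 H"
    unfolding diagonal_from_def using Hc hermite_formD(8)[OF assms]
    by (metis carrier_matD(1) le0 less_trans linorder_neqE_nat)
  finally show ?thesis .
qed

lemma DIAG_correct:
  assumes M: "M \<in> carrier_mat g g" "full_rank g M"
  shows "\<exists>k l U V m.
     diagonal_mat (diag_M A D \<theta> g M k) \<and>
     (\<forall>j<k. \<not> diagonal_mat (diag_M A D \<theta> g M j)) \<and>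
     l = k + k mod 2 \<and>
     (\<forall>i<l. is_gb_matrix A D (diag_M A D \<theta> g M i) (gb_matrix A D (diag_M A D \<theta> g M i)) \<and>
            is_gb_transform A D (diag_M A D \<theta> g M i) (gb_transform A D (diag_M A D \<theta> g M i))) \<and>
     DIAG A D \<theta> g M = Some (l, U, V, diag_M A D \<theta> g M l) \<and>
     U \<in> carrier_mat g g \<and> invertible_mat U \<and>
     V \<in> carrier_mat g g \<and> invertible_mat V \<and>
     U * M * V = mat_diag g m \<and>
     diag_M A D \<theta> g M l = mat_diag g m"
proof -
  let ?N = "diag_M A D \<theta> g M"
  let ?H = "\<lambda>i. gb_matrix A D (?N i)"
  have N: "?N i \<in> carrier_mat g g" "full_rank g (?N i)" for i using diag_M_full_rank[OF M] by auto
  have H: "hermite_form g (row_module (?N i)) (?H i)" for i using full_rank_gb(1)[OF N] .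
  have diag_iff: "diagonal_mat (?N (Suc i)) \<longleftrightarrow> diagonal_from 0 (?H i)" for i
    using diagonal_theta_mat_iff[OF H] by (simp add: diag_M_Suc)
  have "\<exists>i. diagonal_mat (?N i)"
    using iteration_diagonalizes[of g "\<lambda>i. row_module (?N i)" ?H, OF H] diag_iff
    by (metis diag_M_Suc)
  then obtain k where k: "diagonal_mat (?N k)" "\<And>j. j < k \<Longrightarrow> \<not> diagonal_mat (?N j)"
    using exists_least_iff[of "\<lambda>i. diagonal_mat (?N i)"] by blast
  define l where "l = k + k mod 2"
  have diag_l: "diagonal_mat (?N l)"
  proof (cases "even k")
    case True then show ?thesis using k(1) by (simp add: l_def)
  next
    case False
    then obtain i where i: "k = Suc i" by (cases k) auto
    have "diagonal_from 0 (?H i)" using k(1) diag_iff i by simp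
    then have "diagonal_from 0 (?H (Suc i))"
      using diagonal_from_step[OF H[of i]] H[of "Suc i"] by (simp add: diag_M_Suc)
    then have "diagonal_mat (?N (Suc (Suc i)))" using diag_iff by simp
    moreover have "l = Suc (Suc i)" using False i unfolding l_def by presburger
    ultimately show ?thesis by simp
  qed
  have "even l" unfolding l_def by presburger
  obtain U V where UV: "(diag_body A D \<theta> ^^ l) (diag_init g M) = (l, U, V, ?N l)"
    "U \<in> carrier_mat g g" "invertible_mat U" "V \<in> carrier_mat g g" "invertible_mat V" "U * M * V = ?N l"
    using diag_transforms[OF M, of l] \<open>even l\<close> by auto
  have DIAG: "DIAG A D \<theta> g M = Some (l, U, V, ?N l)"
    using DIAG_result[OF k l_def diag_l] UV(1) by simp
  have m: "?N l = mat_diag g (\<lambda>i. ?N l $$ (i, i))"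
    using diag_l N(1)[of l] by (intro eq_matI) (auto simp: mat_diag_def diagonal_mat_def)
  have gb: "\<forall>i<l. is_gb_matrix A D (?N i) (?H i) \<and> is_gb_transform A D (?N i) (gb_transform A D (?N i))"
    using full_rank_gb(2,3)[OF N] by blast
  show ?thesis
    by (intro exI[of _ k] exI[of _ l] exI[of _ U] exI[of _ V] exI[of _ "\<lambda>i. ?N l $$ (i, i)"] conjI)
      (use k UV DIAG m gb l_def in auto)
qed

end

theorem theorem3p6:
  fixes scale :: "'k::field \<Rightarrow> 'r::ring_1 \<Rightarrow> 'r"
    and n g :: nat
    and x :: "nat \<Rightarrow> 'r"
    and D :: 'r
    and A_star R_star A :: "'r set"
    and \<sigma> \<delta> \<theta> :: "'r \<Rightarrow> 'r"
    and \<iota> :: "'r \<Rightarrow> 'q::division_ring"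
    and M :: "'r mat"
  assumes "k_algebra scale"
    and "G_algebra scale n x A_star"
    and "ore_extension R_star A_star D \<sigma> \<delta>"
    and "G_algebra scale (n + 1) (x(n := D)) R_star"
    and "skew_field_of_fractions A A_star"
    and "ore_extension UNIV A D \<sigma> \<delta>"
    and "bij_betw \<sigma> A A"
    and "inj_ring_hom \<iota>"
    and "skew_field_of_fractions UNIV (range \<iota>)"
    and "involution scale \<theta>"
    and "M \<in> carrier_mat g g"
    and "skew_rank (map_mat \<iota> M) = g"
  shows "\<exists>k l U V m.
     diagonal_mat (diag_M A D \<theta> g M k) \<and>
     (\<forall>j<k. \<not> diagonal_mat (diag_M A D \<theta> g M j)) \<and>
     l = k + k mod 2 \<and>
     (\<forall>i<l. is_gb_matrix A D (diag_M A D \<theta> g M i) (gb_matrix A D (diag_M A D \<theta> g M i)) \<and>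
            is_gb_transform A D (diag_M A D \<theta> g M i) (gb_transform A D (diag_M A D \<theta> g M i))) \<and>
     DIAG A D \<theta> g M = Some (l, U, V, diag_M A D \<theta> g M l) \<and>
     U \<in> carrier_mat g g \<and> invertible_mat U \<and>
     V \<in> carrier_mat g g \<and> invertible_mat V \<and>
     U * M * V = mat_diag g m \<and>
     diag_M A D \<theta> g M l = mat_diag g m"
proof -
  have "ore_ring A D \<sigma> \<delta>"
  proof
    show "ore_extension UNIV A D \<sigma> \<delta>" by fact
    show "inj_on \<sigma> A" using \<open>bij_betw \<sigma> A A\<close> by (rule bij_betw_imp_inj_on)
    show "\<exists>b\<in>A. a * b = 1 \<and> b * a = 1" if "a \<in> A" "a \<noteq> 0" for a
      using \<open>skew_field_of_fractions A A_star\<close> that unfolding skew_field_of_fractions_def by blast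
  qed
  moreover have "ore_ring_involution_axioms \<theta>"
  proof
    have "Vector_Spaces.linear scale scale \<theta>" using \<open>involution scale \<theta>\<close> by (simp add: involution_def)
    then show "\<theta> (a + b) = \<theta> a + \<theta> b" for a b
      by (simp add: Vector_Spaces.linear_def module_hom_def module_hom_axioms_def)
  qed (use \<open>involution scale \<theta>\<close> in \<open>auto simp: involution_def\<close>)
  ultimately interpret diag_setting A D \<sigma> \<delta> \<iota> \<theta>
    using \<open>inj_ring_hom \<iota>\<close>
    by (simp add: diag_setting_def ore_ring_in_skew_field_def ore_ring_involution_def)
  have "full_rank g M" by (rule skew_rank_full_rank) fact+
  then show ?thesis using DIAG_correct[OF \<open>M \<in> carrier_mat g g\<close>] by blast
qed

end
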